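(* Let $A(x,y)=\sum_{P}x^{\mathrm{width}(P)}y^{\mathrm{kiss}(P)}$, the sum being over all packing paths $P$, where $\mathrm{kiss}(P)$ is the kissing number of $P$. Then $$A(x,y)=\frac{1-4x^4y+3x^4y^2-\sqrt{1-8x^4y-2x^4y^2+16x^8y^2-8x^8y^3+x^8y^4}}{4x^4y^2}.$$
   Context: Consider the hexagonal packing of the plane by circles of radius $2$ with centers $(2+4i+2j,\,2\sqrt3\,j)$, $i,j\in\mathbb Z$; the origin is the tangency point of two horizontally adjacent circles. The tangency points cut every circle into six arcs. Traversed from left to right these give six types of steps (angles measured on the circle carrying the arc): $U$ from $180^\circ$ to $120^\circ$ (displacement $(1,\sqrt3)$), $F$ from $120^\circ$ to $60^\circ$ (displacement $(2,0)$), $D$ from $60^\circ$ to $0^\circ$ (displacement $(1,-\sqrt3)$), $\overline U$ from $300^\circ$ to $360^\circ$ (displacement $(1,\sqrt3)$), $\overline F$ from $240^\circ$ to $300^\circ$ (displacement $(2,0)$), $\overline D$ from $180^\circ$ to $240^\circ$ (displacement $(1,-\sqrt3)$). A path in the packing starts at the origin, is a concatenation of such arcs of circles of the packing, each starting where the previous one ends, and stays in the quarter plane $x,y\ge 0$. Equivalently, it is a word in $\{U,F,D,\overline U,\overline F,\overline D\}$ whose first step (if any) is $U$, in which $U$ or $\overline F$ can only be followed by $F$ or $\overline U$; $F$ or $\overline D$ only by $\overline F$ or $D$; $\overline U$ or $D$ only by $U$ or $\overline D$; and which never goes below ordinate $0$. A packing path is such a path ending on the $x$-axis. The empty path is allowed.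 The width of a path is the abscissa of its endpoint (so $U,D,\overline U,\overline D$ contribute $1$ and $F,\overline F$ contribute $2$). The kissing number of a packing path is the number of circles of the packing lying below the path (under the path, with center of ordinate $\ge0$, between its starting and ending abscissas) that touch it, touching at a single point (a tangency point) included. The square root is the formal power series with constant term $1$. *)

theory Defs
  imports
    "HOL-Complex_Analysis.Complex_Analysis"
    "HOL-Computational_Algebra.Computational_Algebra"
begin

text \<open>The plane is identified with the type of complex numbers: abscissa \<^const>\<open>Re\<close>,
  ordinate \<^const>\<open>Im\<close>. The circle with centre \<open>c\<close> is \<open>sphere c 2\<close>.\<close>

definition packing_centers :: "complex set" where
  "packing_centers = {Complex (2 + 4 * of_int i + 2 * of_int j) (2 * sqrt 3 * of_int j) | i j. True}"


section \<open>Steps, arcs and paths\<close>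

datatype step = Up | Flat | Down | Up_bar | Flat_bar | Down_bar

fun start_angle :: "step \<Rightarrow> real" where
  "start_angle Up = pi"
| "start_angle Flat = 2 * pi / 3"
| "start_angle Down = pi / 3"
| "start_angle Up_bar = 5 * pi / 3"
| "start_angle Flat_bar = 4 * pi / 3"
| "start_angle Down_bar = pi"

fun end_angle :: "step \<Rightarrow> real" where
  "end_angle Up = 2 * pi / 3"
| "end_angle Flat = pi / 3"
| "end_angle Down = 0"
| "end_angle Up_bar = 2 * pi"
| "end_angle Flat_bar = 5 * pi / 3"
| "end_angle Down_bar = 4 * pi / 3"

text \<open>An arc is given by the centre of the circle carrying it and by its type. All arcs are
  traversed from left to right.\<close>

type_synonym circle_arc = "complex \<times> step"

definition arc_curve :: "circle_arc \<Rightarrow> real \<Rightarrow> complex" where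
  "arc_curve a = part_circlepath (fst a) 2 (start_angle (snd a)) (end_angle (snd a))"

text \<open>The set of points of the path; the empty path is the single point \<open>0\<close>.\<close>

definition path_trace :: "circle_arc list \<Rightarrow> complex set" where
  "path_trace P = insert 0 (\<Union>a\<in>set P. path_image (arc_curve a))"

definition endpoint :: "circle_arc list \<Rightarrow> complex" where
  "endpoint P = (if P = [] then 0 else pathfinish (arc_curve (last P)))"

definition path_in_packing :: "circle_arc list \<Rightarrow> bool" where
  "path_in_packing P \<longleftrightarrow>
     fst ` set P \<subseteq> packing_centers \<and>
     (P \<noteq> [] \<longrightarrow> pathstart (arc_curve (hd P)) = 0) \<and>
     successively (\<lambda>a b. pathfinish (arc_curve a) = pathstart (arc_curve b)) P \<and>
     path_trace P \<subseteq> {z. 0 \<le> Re z \<and> 0 \<le> Im z}"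

definition packing_path :: "circle_arc list \<Rightarrow> bool" where
  "packing_path P \<longleftrightarrow> path_in_packing P \<and> Im (endpoint P) = 0"

definition width :: "circle_arc list \<Rightarrow> real" where
  "width P = Re (endpoint P)"


section \<open>Kissing number\<close>

text \<open>A circle is under the path if no point of the path is strictly below a point of the circle
  with the same abscissa. For circles of the packing with centre between the
  starting and the ending abscissa, this excludes precisely the circles situated above the path.\<close>

definition below_path :: "complex \<Rightarrow> circle_arc list \<Rightarrow> bool" where
  "below_path c P \<longleftrightarrow>
     0 \<le> Im c \<and> 0 \<le> Re c \<and> Re c \<le> width P \<and>
     (\<forall>z\<in>sphere c 2. \<forall>w\<in>path_trace P. Re w = Re z \<longrightarrow> Im z \<le> Im w)"

definition kissing_circles :: "circle_arc list \<Rightarrow> complex set" where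
  "kissing_circles P = {c \<in> packing_centers. below_path c P \<and> sphere c 2 \<inter> path_trace P \<noteq> {}}"

definition kiss :: "circle_arc list \<Rightarrow> nat" where
  "kiss P = card (kissing_circles P)"


section \<open>The generating function\<close>

text \<open>Series in \<open>x\<close> and \<open>y\<close> have type \<^typ>\<open>real fps fps\<close>: the outer variable is \<open>x\<close>, the inner one
  \<open>y\<close>. The coefficient of \<open>x\<^sup>n y\<^sup>k\<close> in \<open>A\<close> is the number of packing paths of width \<open>n\<close> and
  kissing number \<open>k\<close>; by \<open>width_in_Nats\<close>, \<open>finite_packing_paths\<close> and \<open>finite_kissing_circles\<close> below,
  this is the sum over all packing paths.\<close>

definition packing_gf :: "real fps fps" where
  "packing_gf = Abs_fps (\<lambda>n. Abs_fps (\<lambda>k.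
     of_nat (card {P. packing_path P \<and> width P = of_nat n \<and> kiss P = k})))"

definition fps2_sqrt :: "real fps fps \<Rightarrow> real fps fps" where
  "fps2_sqrt D = (THE S. S\<^sup>2 = D \<and> fps_nth (fps_nth S 0) 0 = 1)"


section \<open>Well-definedness\<close>

lemma fps2_sqrt_unique:
  fixes S T :: "real fps fps"
  assumes "S\<^sup>2 = T\<^sup>2" "fps_nth (fps_nth S 0) 0 = 1" "fps_nth (fps_nth T 0) 0 = 1"
  shows "S = T"
proof -
  have "S = T \<or> S = - T" using assms(1) by (simp add: power2_eq_iff)
  moreover have "S \<noteq> - T" using assms(2,3) by auto
  ultimately show ?thesis by blast
qed

fun step_width :: "step \<Rightarrow> nat" where
  "step_width Flat = 2"
| "step_width Flat_bar = 2"
| "step_width _ = 1"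

lemma cos_angles:
  "cos (2 * pi / 3) = - (1 / 2)" "cos (4 * pi / 3) = - (1 / 2)" "cos (5 * pi / 3) = 1 / 2"
proof -
  show "cos (2 * pi / 3) = - (1 / 2)"
    using cos_double_cos[of "pi / 3"] by (simp add: cos_60 power2_eq_square)
  have "cos (4 * pi / 3) = cos (pi / 3 + pi)" by (rule arg_cong[of _ _ cos]) simp
  also have "\<dots> = - cos (pi / 3)" by (rule cos_periodic_pi)
  finally show "cos (4 * pi / 3) = - (1 / 2)" by (simp add: cos_60)
  have "cos (5 * pi / 3) = cos (2 * pi - pi / 3)" by (rule arg_cong[of _ _ cos]) simp
  also have "\<dots> = cos (pi / 3)" by (subst cos_diff) simp
  finally show "cos (5 * pi / 3) = 1 / 2" by (simp add: cos_60)
qed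

lemma pathstart_arc_curve: "pathstart (arc_curve a) = fst a + 2 * cis (start_angle (snd a))"
  and pathfinish_arc_curve: "pathfinish (arc_curve a) = fst a + 2 * cis (end_angle (snd a))"
  by (simp_all add: arc_curve_def cis_conv_exp)

lemma Re_arc_curve:
  "Re (pathfinish (arc_curve a)) = Re (pathstart (arc_curve a)) + real (step_width (snd a))"
  unfolding pathstart_arc_curve pathfinish_arc_curve
  by (cases "snd a") (simp_all add: cos_60 cos_angles)

definition arc_chain :: "circle_arc list \<Rightarrow> bool" where
  "arc_chain P \<longleftrightarrow> (P \<noteq> [] \<longrightarrow> pathstart (arc_curve (hd P)) = 0) \<and>
     successively (\<lambda>a b. pathfinish (arc_curve a) = pathstart (arc_curve b)) P"

lemma arc_chain_snoc:
  "arc_chain (P @ [a]) \<longleftrightarrow> arc_chain P \<and> pathstart (arc_curve a) = endpoint P"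
  by (cases "P = []") (auto simp: arc_chain_def endpoint_def successively_append_iff)

lemma width_arc_chain: "arc_chain P \<Longrightarrow> width P = real (sum_list (map (step_width \<circ> snd) P))"
proof (induction P rule: rev_induct)
  case Nil
  show ?case by (simp add: width_def endpoint_def)
next
  case (snoc a P)
  then show ?case
    using Re_arc_curve[of a] by (auto simp: arc_chain_snoc width_def endpoint_def)
qed

lemma length_le_width:
  assumes "arc_chain P"
  shows "real (length P) \<le> width P"
proof -
  have step: "1 \<le> step_width s" for s by (cases s) auto
  have "length P \<le> sum_list (map (step_width \<circ> snd) P)"
  proof (induction P)
    case (Cons a P)
    then show ?case using add_mono[OF step[of "snd a"]] by fastforce
  qed simp
  then show ?thesis using width_arc_chain[OF assms] by simp
qed

lemma arc_chain_eqI: "arc_chain P \<Longrightarrow> arc_chain Q \<Longrightarrow> map snd P = map snd Q \<Longrightarrow> P = Q"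
proof (induction P arbitrary: Q rule: rev_induct)
  case Nil
  then show ?case by simp
next
  case (snoc a P)
  then obtain b Q' where Q: "Q = Q' @ [b]" by (cases Q rule: rev_cases) auto
  with snoc have "P = Q'" "snd a = snd b" by (auto simp: arc_chain_snoc)
  moreover have "pathstart (arc_curve a) = pathstart (arc_curve b)"
    using snoc.prems Q \<open>P = Q'\<close> by (simp add: arc_chain_snoc)
  ultimately show ?case using Q by (simp add: pathstart_arc_curve prod_eq_iff)
qed

lemma width_in_Nats: "packing_path P \<Longrightarrow> width P \<in> \<nat>"
  by (simp add: packing_path_def path_in_packing_def width_arc_chain arc_chain_def)

lemma finite_packing_paths: "finite {P. packing_path P \<and> width P = of_nat n}"
proof -
  have UNIV_step: "(UNIV :: step set) = {Up, Flat, Down, Up_bar, Flat_bar, Down_bar}"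
    using step.exhaust by blast
  have fin: "finite (UNIV :: step set)" unfolding UNIV_step by simp
  let ?A = "{P. packing_path P \<and> width P = of_nat n}"
  have chain: "arc_chain P" if "P \<in> ?A" for P
    using that by (auto simp: packing_path_def path_in_packing_def arc_chain_def)
  have "length P \<le> n" if "P \<in> ?A" for P
    using length_le_width[OF chain[OF that]] that by simp
  then have "map snd ` ?A \<subseteq> {w. set w \<subseteq> UNIV \<and> length w \<le> n}"
    by auto
  then have "finite (map snd ` ?A)"
    using finite_lists_length_le[OF fin] by (rule finite_subset)
  moreover have "inj_on (map snd) ?A"
    by (intro inj_onI arc_chain_eqI chain)
  ultimately show ?thesis by (rule finite_imageD)
qed

lemma finite_packing_centers_Int_cball: "finite (packing_centers \<inter> cball 0 R)"
proof -
  define K where "K = \<lceil>2 * \<bar>R\<bar> + 2\<rceil>"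
  have K: "\<bar>k\<bar> \<le> K" if "\<bar>real_of_int k\<bar> \<le> 2 * \<bar>R\<bar> + 2" for k
  proof -
    have "real_of_int \<bar>k\<bar> \<le> of_int K" using that unfolding K_def by linarith
    then show ?thesis by linarith
  qed
  have "packing_centers \<inter> cball 0 R \<subseteq>
      (\<lambda>(i, j). Complex (2 + 4 * of_int i + 2 * of_int j) (2 * sqrt 3 * of_int j)) `
        ({-K..K} \<times> {-K..K})"
  proof
    fix c assume c: "c \<in> packing_centers \<inter> cball 0 R"
    then obtain i j where
      ij: "c = Complex (2 + 4 * of_int i + 2 * of_int j) (2 * sqrt 3 * of_int j)"
      by (auto simp: packing_centers_def)
    have "norm c \<le> \<bar>R\<bar>" using c by auto
    then have re: "\<bar>Re c\<bar> \<le> \<bar>R\<bar>" and im: "\<bar>Im c\<bar> \<le> \<bar>R\<bar>"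
      using abs_Re_le_cmod[of c] abs_Im_le_cmod[of c] by linarith+
    have "1 * \<bar>real_of_int j\<bar> \<le> (2 * sqrt 3) * \<bar>real_of_int j\<bar>"
    proof (rule mult_right_mono)
      have "1 \<le> sqrt 3" by simp
      then show "1 \<le> 2 * sqrt 3" by linarith
    qed simp
    then have j: "\<bar>real_of_int j\<bar> \<le> \<bar>R\<bar>" using im by (simp add: ij abs_mult)
    with re have i: "\<bar>real_of_int i\<bar> \<le> 2 * \<bar>R\<bar> + 2" by (simp add: ij)
    have "\<bar>i\<bar> \<le> K" "\<bar>j\<bar> \<le> K" using i j by (auto intro!: K)
    then show "c \<in> (\<lambda>(i, j). Complex (2 + 4 * of_int i + 2 * of_int j) (2 * sqrt 3 * of_int j)) `
        ({-K..K} \<times> {-K..K})"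
      by (intro image_eqI[of _ _ "(i, j)"]) (auto simp: ij abs_le_iff)
  qed
  then show ?thesis by (rule finite_subset) auto
qed

lemma finite_kissing_circles: "finite (kissing_circles P)"
proof -
  have "compact (path_trace P)"
    by (auto simp: path_trace_def arc_curve_def compact_path_image
        intro!: compact_insert compact_UN)
  then obtain R where R: "\<forall>z\<in>path_trace P. norm z \<le> R"
    using compact_imp_bounded bounded_iff by metis
  have "norm c \<le> R + 2" if "c \<in> kissing_circles P" for c
  proof -
    obtain z where "z \<in> path_trace P" "norm (c - z) = 2"
      using \<open>c \<in> kissing_circles P\<close> by (auto simp: kissing_circles_def dist_norm)
    then show ?thesis using R norm_triangle_sub[of c z] by force
  qed
  then have "kissing_circles P \<subseteq> packing_centers \<inter> cball 0 (R + 2)"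
    by (simp add: subset_iff) (simp add: kissing_circles_def)
  then show ?thesis by (rule finite_subset) (rule finite_packing_centers_Int_cball)
qed

end

theory Submission
  imports Defs
begin

text \<open>The path is read as a run of an automaton whose states are the tangency points. A circle below
  the path touches it exactly when its point at \<open>120\<close> or at \<open>60\<close> degrees is a vertex of the path,
  so the kissing number is the number of steps \<open>U\<close>, \<open>F_bar\<close> and \<open>D_bar\<close>, not counting a \<open>D_bar\<close>
  that immediately follows a \<open>U_bar\<close>. The generating functions of the runs started in the various
  states are the unique solution of an infinite linear system, because every step has positive
  width. The first-passage decomposition suggests a solution: with \<open>A\<close> the root of
  \<open>A - 1 = x^4 y (2 - y + y A) (2 A - 1)\<close>, the solutions are geometric in the level, and substituting
  them into the system verifies the guess without any bijection between words.\<close>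


section \<open>An automaton for packing paths\<close>

text \<open>A state records the tangency point reached so far. \<open>Pole\<close> and \<open>Summit\<close> are the contacts of
  horizontally adjacent circles, a \<open>Summit\<close> being one that has just been reached by an
  \<^const>\<open>Up_bar\<close> step; \<open>Lft\<close> and \<open>Rgt\<close> are the points at \<open>120\<close> and \<open>60\<close> degrees of the circle
  below them. The ordinate, in units of \<open>sqrt 3\<close>, is \<open>2 * m\<close> in the first two cases and
  \<open>2 * m + 1\<close> in the other two.\<close>

datatype kind = Pole | Summit | Lft | Rgt

fun next_state :: "kind \<times> nat \<Rightarrow> step \<Rightarrow> (kind \<times> nat) option" where
  "next_state (Pole, m) Up = Some (Lft, m)"
| "next_state (Summit, m) Up = Some (Lft, m)"
| "next_state (Pole, Suc m) Down_bar = Some (Rgt, m)"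
| "next_state (Summit, Suc m) Down_bar = Some (Rgt, m)"
| "next_state (Lft, m) Flat = Some (Rgt, m)"
| "next_state (Lft, m) Up_bar = Some (Summit, Suc m)"
| "next_state (Rgt, m) Flat_bar = Some (Lft, m)"
| "next_state (Rgt, m) Down = Some (Pole, m)"
| "next_state _ _ = None"

definition final_state :: "kind \<times> nat \<Rightarrow> bool" where
  "final_state \<sigma> \<longleftrightarrow> fst \<sigma> \<in> {Pole, Summit} \<and> snd \<sigma> = 0"

text \<open>After \<^const>\<open>Up_bar\<close>, the step \<^const>\<open>Down_bar\<close> returns to the circle that was left at
  \<open>120\<close> degrees, so it is the only arrival at a point \<open>Lft\<close> or \<open>Rgt\<close> by \<^const>\<open>Up\<close>,
  \<^const>\<open>Flat_bar\<close> or \<^const>\<open>Down_bar\<close> that meets no new circle.\<close>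

fun new_circles :: "kind \<Rightarrow> step \<Rightarrow> nat" where
  "new_circles _ Up = 1"
| "new_circles _ Flat_bar = 1"
| "new_circles Summit Down_bar = 0"
| "new_circles _ Down_bar = 1"
| "new_circles _ _ = 0"

fun accepts :: "kind \<times> nat \<Rightarrow> step list \<Rightarrow> bool" where
  "accepts \<sigma> [] = final_state \<sigma>"
| "accepts \<sigma> (s # w) = (case next_state \<sigma> s of None \<Rightarrow> False | Some \<tau> \<Rightarrow> accepts \<tau> w)"

fun circle_count :: "kind \<times> nat \<Rightarrow> step list \<Rightarrow> nat" where
  "circle_count \<sigma> [] = 0"
| "circle_count \<sigma> (s # w) = new_circles (fst \<sigma>) s +
     (case next_state \<sigma> s of None \<Rightarrow> 0 | Some \<tau> \<Rightarrow> circle_count \<tau> w)"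

definition word_width :: "step list \<Rightarrow> nat" where
  "word_width w = sum_list (map step_width w)"

definition words :: "kind \<times> nat \<Rightarrow> nat \<Rightarrow> nat \<Rightarrow> step list set" where
  "words \<sigma> n k = {w. accepts \<sigma> w \<and> word_width w = n \<and> circle_count \<sigma> w = k}"

definition state_gf :: "kind \<times> nat \<Rightarrow> real fps fps" where
  "state_gf \<sigma> = Abs_fps (\<lambda>n. Abs_fps (\<lambda>k. of_nat (card (words \<sigma> n k))))"

text \<open>The system is an operator on arbitrary families of series, so that the counting series
  and a guessed family can both be tested against it.\<close>

definition transition_sum :: "(kind \<times> nat \<Rightarrow> real fps fps) \<Rightarrow> kind \<times> nat \<Rightarrow> real fps fps" where
  "transition_sum F \<sigma> = (\<Sum>s\<in>UNIV. case next_state \<sigma> s of None \<Rightarrow> 0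
     | Some \<tau> \<Rightarrow> fps_X ^ step_width s * fps_const (fps_X ^ new_circles (fst \<sigma>) s) * F \<tau>)"

lemma UNIV_step: "(UNIV :: step set) = {Up, Flat, Down, Up_bar, Flat_bar, Down_bar}"
  using step.exhaust by blast

lemma finite_UNIV_step [simp]: "finite (UNIV :: step set)"
  by (simp add: UNIV_step)

lemma step_width_pos: "0 < step_width s"
  by (cases s) auto

section \<open>Decomposition of words by their first step\<close>

lemma length_le_word_width: "length w \<le> word_width w"
proof (induction w)
  case (Cons s w)
  then show ?case using step_width_pos[of s] by (simp add: word_width_def)
qed (simp add: word_width_def)

lemma finite_words: "finite (words \<sigma> n k)"
proof (rule finite_subset)
  show "words \<sigma> n k \<subseteq> {w. set w \<subseteq> UNIV \<and> length w \<le> n}"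
    using length_le_word_width by (auto simp: words_def)
qed (rule finite_lists_length_le, simp)

definition words_via :: "kind \<times> nat \<Rightarrow> nat \<Rightarrow> nat \<Rightarrow> step \<Rightarrow> step list set" where
  "words_via \<sigma> n k s = {w. s # w \<in> words \<sigma> n k}"

lemma card_words_via:
  "real (card (words_via \<sigma> n k s)) = fps_nth (fps_nth (case next_state \<sigma> s of None \<Rightarrow> 0
     | Some \<tau> \<Rightarrow> fps_X ^ step_width s * fps_const (fps_X ^ new_circles (fst \<sigma>) s) * state_gf \<tau>) n) k"
proof (cases "next_state \<sigma> s")
  case None
  then show ?thesis by (simp add: words_via_def words_def)
next
  case (Some \<tau>)
  \<comment> \<open>The guard handles truncated subtraction: where it fails, the set is empty and
    the coefficient of a multiple of these powers of \<open>fps_X\<close> is 0.\<close>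
  have "words_via \<sigma> n k s = (if step_width s \<le> n \<and> new_circles (fst \<sigma>) s \<le> k
      then words \<tau> (n - step_width s) (k - new_circles (fst \<sigma>) s) else {})"
    using Some by (auto simp: words_via_def words_def word_width_def)
  then show ?thesis
    using Some by (simp add: mult.assoc fps_X_power_mult_nth state_gf_def)
qed

lemma card_words:
  "card (words \<sigma> n k) = of_bool (final_state \<sigma> \<and> n = 0 \<and> k = 0) + (\<Sum>s\<in>UNIV. card (words_via \<sigma> n k s))"
proof -
  have eq: "words \<sigma> n k = (if final_state \<sigma> \<and> n = 0 \<and> k = 0 then {[]} else {}) \<union>
      (\<Union>s. (#) s ` words_via \<sigma> n k s)" (is "_ = ?N \<union> ?C")
  proof (rule set_eqI)
    fix w show "w \<in> words \<sigma> n k \<longleftrightarrow> w \<in> ?N \<union> ?C"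
      by (cases w) (auto simp: words_def words_via_def word_width_def)
  qed
  have fin: "finite ((#) s ` words_via \<sigma> n k s)" for s
    by (rule finite_subset[OF _ finite_words[of \<sigma> n k]]) (auto simp: words_via_def)
  have "card (words \<sigma> n k) = card ?N + card ?C"
    unfolding eq by (rule card_Un_disjoint) (use fin in auto)
  also have "card ?C = (\<Sum>s\<in>UNIV. card ((#) s ` words_via \<sigma> n k s))"
    by (rule card_UN_disjoint) (use fin in auto)
  also have "\<dots> = (\<Sum>s\<in>UNIV. card (words_via \<sigma> n k s))"
    by (intro sum.cong refl card_image) auto
  finally show ?thesis by simp
qed

lemma state_gf_eq: "state_gf \<sigma> = of_bool (final_state \<sigma>) + transition_sum state_gf \<sigma>"
proof (intro fps_ext)
  fix n k
  show "fps_nth (fps_nth (state_gf \<sigma>) n) k =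
      fps_nth (fps_nth (of_bool (final_state \<sigma>) + transition_sum state_gf \<sigma>) n) k"
    by (simp add: state_gf_def[of \<sigma>] card_words transition_sum_def fps_sum_nth card_words_via)
qed

text \<open>Every transition carries a positive power of \<open>x\<close>, so coefficient
  \<open>n\<close> at a state depends only on smaller coefficients. Strong induction on
  \<open>n\<close>, for all states at once, copes with the infinitely many levels.\<close>

lemma transition_system_unique:
  assumes F: "\<And>\<sigma>. F \<sigma> = of_bool (final_state \<sigma>) + transition_sum F \<sigma>"
    and G: "\<And>\<sigma>. G \<sigma> = of_bool (final_state \<sigma>) + transition_sum G \<sigma>"
  shows "F = G"
proof -
  have "fps_nth (F \<sigma>) n = fps_nth (G \<sigma>) n" for n \<sigma>
  proof (induction n arbitrary: \<sigma> rule: less_induct)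
    case (less n)
    have shorter: "n - step_width s < n" if "\<not> n < step_width s" for s
      using that step_width_pos[of s] by linarith
    have "fps_nth (transition_sum F \<sigma>) n = fps_nth (transition_sum G \<sigma>) n"
      unfolding transition_sum_def fps_sum_nth
    proof (intro sum.cong refl)
      fix s
      show "fps_nth (case next_state \<sigma> s of None \<Rightarrow> 0
          | Some \<tau> \<Rightarrow> fps_X ^ step_width s * fps_const (fps_X ^ new_circles (fst \<sigma>) s) * F \<tau>) n =
        fps_nth (case next_state \<sigma> s of None \<Rightarrow> 0
          | Some \<tau> \<Rightarrow> fps_X ^ step_width s * fps_const (fps_X ^ new_circles (fst \<sigma>) s) * G \<tau>) n"
        using less[OF shorter[of s]]
        by (cases "next_state \<sigma> s") (simp_all add: mult.assoc fps_X_power_mult_nth)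
    qed
    then show ?case by (metis F G fps_add_nth)
  qed
  then have "F \<sigma> = G \<sigma>" for \<sigma>
    by (rule fps_ext)
  then show ?thesis ..
qed


section \<open>Solving the linear system\<close>

text \<open>Contraction argument for the X-adic topology: each application of \<open>\<Phi>\<close>
  settles one more coefficient. For \<open>n = 0\<close> the hypothesis says that the constant term
  of \<open>\<Phi> f\<close> does not depend on \<open>f\<close>.\<close>

lemma fps_fixpoint_exists:
  fixes \<Phi> :: "'a::zero fps \<Rightarrow> 'a fps"
  assumes "\<And>f g n. (\<And>m. m < n \<Longrightarrow> fps_nth f m = fps_nth g m) \<Longrightarrow> fps_nth (\<Phi> f) n = fps_nth (\<Phi> g) n"
  shows "\<exists>f. \<Phi> f = f"
proof -
  define it where "it k = (\<Phi> ^^ k) 0" for k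
  have stable: "fps_nth (it (Suc k)) n = fps_nth (it k) n" if "n < k" for n k
    using that
  proof (induction k arbitrary: n)
    case (Suc k)
    have "fps_nth (\<Phi> (it (Suc k))) n = fps_nth (\<Phi> (it k)) n"
      by (rule assms) (use Suc in auto)
    then show ?case by (simp add: it_def)
  qed simp
  have lim: "fps_nth (it k) n = fps_nth (it (Suc n)) n" if "n < k" for n k
    using that
  proof (induction k)
    case (Suc k)
    then show ?case using stable[of n k] by (cases "n = k") auto
  qed simp
  \<comment> \<open>Coefficient \<open>n\<close> is constant from iterate \<open>n + 1\<close> on,
    so this diagonal is the limit; it agrees with \<open>it n\<close> below
    \<open>n\<close>.\<close>
  define f where "f = Abs_fps (\<lambda>n. fps_nth (it (Suc n)) n)"
  have "fps_nth (\<Phi> f) n = fps_nth f n" for n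
  proof -
    have "fps_nth (\<Phi> f) n = fps_nth (\<Phi> (it n)) n"
      by (rule assms) (simp add: f_def lim[of _ n])
    then show ?thesis by (simp add: f_def it_def)
  qed
  then show ?thesis by (intro exI[of _ f] fps_ext)
qed

text \<open>Supplies the series from which the guess is built. The factor \<open>x ^ 4\<close> makes
  each coefficient of the right-hand side depend only on smaller coefficients of
  \<open>A\<close>.\<close>

lemma packing_equation_solution:
  fixes x y :: "real fps fps"
  defines "x \<equiv> fps_X"
  obtains A where "A = 1 + x ^ 4 * y * (2 - y + y * A) * (2 * A - 1)"
proof -
  define \<Psi> where "\<Psi> A = y * (2 - y + y * A) * (2 * A - 1)" for A
  have "\<exists>A. 1 + x ^ 4 * \<Psi> A = A"
  proof (rule fps_fixpoint_exists)
    fix f g :: "real fps fps" and n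
    assume eq: "\<And>m. m < n \<Longrightarrow> fps_nth f m = fps_nth g m"
    have "fps_nth (\<Psi> f) m = fps_nth (\<Psi> g) m" if "m < n" for m
    proof -
      have mult: "fps_nth (a * b) i = fps_nth (a' * b') i"
        if "i < n" "\<And>i. i < n \<Longrightarrow> fps_nth a i = fps_nth a' i"
          "\<And>i. i < n \<Longrightarrow> fps_nth b i = fps_nth b' i" for a b a' b' :: "real fps fps" and i
        unfolding fps_mult_nth using that by (intro sum.cong) auto
      show ?thesis unfolding \<Psi>_def
        by (rule mult[OF that]; (rule mult)?) (auto intro!: mult simp: eq)
    qed
    then show "fps_nth (1 + x ^ 4 * \<Psi> f) n = fps_nth (1 + x ^ 4 * \<Psi> g) n"
      by (simp add: x_def fps_X_power_mult_nth)
  qed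
  then obtain A where "1 + x ^ 4 * \<Psi> A = A" by blast
  then have "A = 1 + x ^ 4 * y * (2 - y + y * A) * (2 * A - 1)"
    by (simp add: \<Psi>_def mult.assoc)
  then show ?thesis by (rule that)
qed

lemma transition_sum_simps:
  fixes x y :: "real fps fps"
  defines "x \<equiv> fps_X" and "y \<equiv> fps_const fps_X"
  shows "transition_sum F (Pole, 0) = x * y * F (Lft, 0)"
    and "transition_sum F (Summit, 0) = x * y * F (Lft, 0)"
    and "transition_sum F (Pole, Suc m) = x * y * F (Lft, Suc m) + x * y * F (Rgt, m)"
    and "transition_sum F (Summit, Suc m) = x * y * F (Lft, Suc m) + x * F (Rgt, m)"
    and "transition_sum F (Lft, m) = x\<^sup>2 * F (Rgt, m) + x * F (Summit, Suc m)"
    and "transition_sum F (Rgt, m) = x\<^sup>2 * y * F (Lft, m) + x * F (Pole, m)"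
  by (simp_all add: transition_sum_def UNIV_step x_def y_def)

text \<open>The guess follows the successive first passages to lower levels; the equations of the
  system then become polynomial identities.\<close>

lemma packing_equation_state_gf:
  fixes x y A :: "real fps fps"
  defines "x \<equiv> fps_X" and "y \<equiv> fps_const fps_X"
  assumes A: "A = 1 + x ^ 4 * y * (2 - y + y * A) * (2 * A - 1)"
  shows "state_gf (Pole, 0) = A"
proof -
  \<comment> \<open>\<open>G\<close> counts the paths from a point \<open>Lft\<close> to the point \<open>Rgt\<close> of the same circle, namely
    \<^const>\<open>Flat\<close> or \<^const>\<open>Up_bar\<close>, an excursion and \<^const>\<open>Down_bar\<close>; \<open>i = 1 / (1 - s)\<close> sums
    over the repetitions of \<^const>\<open>Flat_bar\<close> followed by \<open>G\<close>.\<close>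
  define G where "G = x\<^sup>2 * (2 - y + y * A)"
  define s where "s = x\<^sup>2 * y * G"
  \<comment> \<open>\<open>s\<close> is divisible by \<open>x^2\<close>, so the inverse of
    \<open>1 - s\<close> arises as a fixed point.\<close>
  have "\<exists>i. 1 + s * i = i"
  proof (rule fps_fixpoint_exists)
    fix f g :: "real fps fps" and n
    assume "\<And>m. m < n \<Longrightarrow> fps_nth f m = fps_nth g m"
    then have "fps_nth (y * G * f) m = fps_nth (y * G * g) m" if "m < n" for m
      unfolding fps_mult_nth[of "y * G"] using that by (intro sum.cong) auto
    then show "fps_nth (1 + s * f) n = fps_nth (1 + s * g) n"
      by (simp add: s_def x_def mult.assoc fps_X_power_mult_nth)
  qed
  then obtain i where i: "i = 1 + s * i" by metis
  have s: "s = x ^ 4 * y * (2 - y + y * A)"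
    by (simp add: s_def G_def power4_eq_xxxx power2_eq_square)
  have A': "A = 1 + s * (2 * A - 1)" using A by (simp add: s)
  \<comment> \<open>First-passage form: a nonempty excursion is \<open>Up\<close>, a passage counted
    by \<open>G\<close>, repetitions counted by \<open>i\<close>, \<open>Down\<close> and a further
    excursion, with total weight \<open>s * A * i\<close>.\<close>
  have Ai: "A = 1 + s * A * i" using i A' by algebra
  \<comment> \<open>Series of the runs from \<open>Rgt\<close> at level \<open>m\<close>: leaving a
    level takes repetitions \<open>i\<close>, \<open>Down\<close>, an excursion \<open>A\<close> and
    \<open>Down_bar\<close>; at level 0 the final \<open>Down_bar\<close> is missing.\<close>
  define c where "c m = (x\<^sup>2 * y * A * i) ^ m * (x * A * i)" for m
  \<comment> \<open>An excursion from \<open>Summit\<close> is empty, and the following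
    \<open>Down_bar\<close> weighs \<open>x\<close>, or it ends at \<open>Pole\<close>, and the
    \<open>Down_bar\<close> weighs \<open>x * y\<close>. This gives the factor
    \<open>x * (1 + y * (A - 1))\<close>.\<close>
  define F where "F \<sigma> = (case \<sigma> of
      (Pole, m) \<Rightarrow> (case m of 0 \<Rightarrow> A | Suc l \<Rightarrow> A * x * y * c l)
    | (Summit, m) \<Rightarrow> (case m of 0 \<Rightarrow> A | Suc l \<Rightarrow> x * (1 + y * (A - 1)) * c l)
    | (Lft, m) \<Rightarrow> G * c m
    | (Rgt, m) \<Rightarrow> c m)" for \<sigma>
  have c0: "c 0 = x * A * i" and cS: "c (Suc m) = x\<^sup>2 * y * A * i * c m" for m
    by (simp_all add: c_def)
  have "F \<sigma> = of_bool (final_state \<sigma>) + transition_sum F \<sigma>" for \<sigma>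
  proof -
    obtain k m where \<sigma>: "\<sigma> = (k, m)" by fastforce
    note simps = \<sigma> F_def final_state_def transition_sum_simps[folded x_def y_def]
    show ?thesis
    proof (cases k)
      case Pole
      show ?thesis
      proof (cases m)
        case 0
        have "A = 1 + x * y * (G * c 0)" using Ai s_def c0 by algebra
        then show ?thesis using Pole 0 by (simp add: simps)
      next
        case (Suc l)
        have "A * x * y * c l = x * y * (G * c (Suc l)) + x * y * c l"
          using Ai s_def cS[of l] by algebra
        then show ?thesis using Pole Suc by (simp add: simps)
      qed
    next
      case Summit
      show ?thesis
      proof (cases m)
        case 0
        have "A = 1 + x * y * (G * c 0)" using Ai s_def c0 by algebra
        then show ?thesis using Summit 0 by (simp add: simps)
      next
        case (Suc l)
        have "x * (1 + y * (A - 1)) * c l = x * y * (G * c (Suc l)) + x * c l"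
          using Ai s_def cS[of l] by algebra
        then show ?thesis using Summit Suc by (simp add: simps)
      qed
    next
      case Lft
      have "G * c m = x\<^sup>2 * c m + x * (x * (1 + y * (A - 1)) * c m)"
        using G_def by algebra
      then show ?thesis using Lft by (simp add: simps)
    next
      case Rgt
      show ?thesis
      proof (cases m)
        case 0
        have "c 0 = x\<^sup>2 * y * (G * c 0) + x * A" using i s_def c0 by algebra
        then show ?thesis using Rgt 0 by (simp add: simps)
      next
        case (Suc l)
        have "c (Suc l) = x\<^sup>2 * y * (G * c (Suc l)) + x * (A * x * y * c l)"
          using i s_def cS[of l] by algebra
        then show ?thesis using Rgt Suc by (simp add: simps)
      qed
    qed
  qed
  then have "state_gf = F"
    by (intro transition_system_unique state_gf_eq)
  then have "state_gf (Pole, 0) = F (Pole, 0)" by (rule fun_cong)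
  then show ?thesis by (simp add: F_def)
qed

section \<open>From the quadratic equation to the closed form\<close>

lemma complete_square:
  fixes a b c z :: "'a::comm_ring_1"
  shows "(2 * a * z + b)\<^sup>2 = 4 * a * (a * z\<^sup>2 + b * z + c) + (b\<^sup>2 - 4 * a * c)"
  by (simp add: algebra_simps power2_eq_square)

text \<open>The equation is a quadratic in \<open>A\<close> with the radicand as discriminant, so
  completing the square makes \<open>- (2 * a * A + b)\<close> a square root of it. Since
  \<open>b\<close> has constant term -1, this is the root with constant term 1.\<close>

lemma packing_equation_closed_form:
  fixes x y A :: "real fps fps"
  defines "x \<equiv> fps_X" and "y \<equiv> fps_const fps_X"
  assumes A: "A = 1 + x ^ 4 * y * (2 - y + y * A) * (2 * A - 1)"
  shows "4 * x^4 * y^2 * A = 1 - 4 * x^4 * y + 3 * x^4 * y^2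
      - fps2_sqrt (1 - 8 * x^4 * y - 2 * x^4 * y^2 + 16 * x^8 * y^2 - 8 * x^8 * y^3 + x^8 * y^4)"
    (is "_ = ?N - fps2_sqrt ?D")
proof -
  define S where "S = ?N - 4 * x^4 * y^2 * A"
  define a where "a = 2 * x ^ 4 * y\<^sup>2"
  define b where "b = 4 * x ^ 4 * y - 3 * x ^ 4 * y\<^sup>2 - 1"
  define c where "c = 1 - x ^ 4 * y * (2 - y)"
  have root: "a * A\<^sup>2 + b * A + c = 0"
  proof -
    have "a * A\<^sup>2 + b * A + c = 1 + x ^ 4 * y * (2 - y + y * A) * (2 * A - 1) - A"
      by (simp add: a_def b_def c_def algebra_simps power2_eq_square)
    then show ?thesis using A by simp
  qed
  have S: "S = - (2 * a * A + b)"
    by (simp add: S_def a_def b_def)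
  have "S\<^sup>2 = 4 * a * (a * A\<^sup>2 + b * A + c) + (b\<^sup>2 - 4 * a * c)"
    unfolding S power2_minus by (rule complete_square)
  also have "\<dots> = b\<^sup>2 - 4 * a * c" by (simp add: root)
  also have "\<dots> = ?D"
    by (simp add: a_def b_def c_def algebra_simps power_numeral_reduce)
  finally have SD: "S\<^sup>2 = ?D" .
  have S0: "fps_nth (fps_nth S 0) 0 = 1"
    by (simp add: S_def x_def fps_mult_nth_0 mult.assoc numeral_fps_const)
  have "fps2_sqrt ?D = S"
    unfolding fps2_sqrt_def
  proof (rule the_equality)
    show "S\<^sup>2 = ?D \<and> fps_nth (fps_nth S 0) 0 = 1" by (rule conjI[OF SD S0])
    show "T = S" if "T\<^sup>2 = ?D \<and> fps_nth (fps_nth T 0) 0 = 1" for T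
      by (rule fps2_sqrt_unique[OF trans[OF conjunct1[OF that] SD[symmetric]] conjunct2[OF that] S0])
  qed
  then show ?thesis by (simp add: S_def)
qed

text \<open>The denominator of the theorem is not a unit, so the quotient is formed in the fraction
  field and reduced here to an identity of series.\<close>

lemma to_fract_eq_divide:
  assumes "b \<noteq> 0" "b * a = c"
  shows "to_fract a = to_fract c / to_fract b"
  using assms by (auto simp: to_fract_def eq_fract)


section \<open>Arcs in integer coordinates\<close>

text \<open>In units of \<open>1\<close> horizontally and \<open>sqrt 3\<close> vertically all centres and tangency points have
  integer coordinates.\<close>

definition lattice_point :: "int \<Rightarrow> int \<Rightarrow> complex" where
  "lattice_point x y = Complex (of_int x) (sqrt 3 * of_int y)"

text \<open>In these units a centre is \<open>(2 + 4 * i + 2 * j, 2 * j)\<close>, so that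
  \<open>x - y - 2 = 4 * i\<close>.\<close>

definition is_center :: "int \<Rightarrow> int \<Rightarrow> bool" where
  "is_center x y \<longleftrightarrow> even y \<and> 4 dvd x - y - 2"

fun start_dx :: "step \<Rightarrow> int" where
  "start_dx Up = -2"
| "start_dx Flat = -1"
| "start_dx Down = 1"
| "start_dx Up_bar = 1"
| "start_dx Flat_bar = -1"
| "start_dx Down_bar = -2"

fun start_dy :: "step \<Rightarrow> int" where
  "start_dy Up = 0"
| "start_dy Flat = 1"
| "start_dy Down = 1"
| "start_dy Up_bar = -1"
| "start_dy Flat_bar = -1"
| "start_dy Down_bar = 0"

fun rise :: "step \<Rightarrow> int" where
  "rise Up = 1"
| "rise Flat = 0"
| "rise Down = -1"
| "rise Up_bar = 1"
| "rise Flat_bar = 0"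
| "rise Down_bar = -1"

abbreviation run :: "step \<Rightarrow> int" where
  "run s \<equiv> int (step_width s)"

fun upper :: "step \<Rightarrow> bool" where
  "upper Up = True"
| "upper Flat = True"
| "upper Down = True"
| "upper _ = False"

abbreviation center_from :: "int \<Rightarrow> int \<Rightarrow> step \<Rightarrow> bool" where
  "center_from x y s \<equiv> is_center (x - start_dx s) (y - start_dy s)"

text \<open>Arcs are indexed by their initial point instead of their centre, so that following a
  word means adding \<open>run\<close> and \<open>rise\<close>.\<close>

definition arc_from :: "int \<Rightarrow> int \<Rightarrow> step \<Rightarrow> circle_arc" where
  "arc_from x y s = (lattice_point (x - start_dx s) (y - start_dy s), s)"

lemma lattice_point_eq_iff [simp]: "lattice_point x y = lattice_point x' y' \<longleftrightarrow> x = x' \<and> y = y'"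
  by (auto simp: lattice_point_def)

lemma Re_lattice_point [simp]: "Re (lattice_point x y) = of_int x"
  and Im_lattice_point [simp]: "Im (lattice_point x y) = sqrt 3 * of_int y"
  by (simp_all add: lattice_point_def)

lemma lattice_point_add:
  "lattice_point x y + lattice_point x' y' = lattice_point (x + x') (y + y')"
  by (simp add: complex_eq_iff algebra_simps)

lemma lattice_point_0: "lattice_point 0 0 = 0"
  by (simp add: complex_eq_iff)

lemma packing_centers_eq: "packing_centers = {lattice_point x y | x y. is_center x y}"
proof (intro equalityI subsetI)
  fix c assume "c \<in> packing_centers"
  then obtain i j where
    c: "c = Complex (2 + 4 * of_int i + 2 * of_int j) (2 * sqrt 3 * of_int j)"
    by (auto simp: packing_centers_def)
  have "c = lattice_point (2 + 4 * i + 2 * j) (2 * j)" by (simp add: c complex_eq_iff)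
  moreover have "is_center (2 + 4 * i + 2 * j) (2 * j)" by (simp add: is_center_def)
  ultimately show "c \<in> {lattice_point x y | x y. is_center x y}" by blast
next
  fix c assume "c \<in> {lattice_point x y | x y. is_center x y}"
  then obtain x y where c: "c = lattice_point x y" and "is_center x y" by blast
  then obtain j i where "y = 2 * j" "x - y - 2 = 4 * i"
    unfolding is_center_def by (metis dvdE)
  then have "c = Complex (2 + 4 * of_int i + 2 * of_int j) (2 * sqrt 3 * of_int j)"
    using c by (simp add: complex_eq_iff algebra_simps)
  then show "c \<in> packing_centers" unfolding packing_centers_def by blast
qed

lemma sin_angles:
  "sin (2 * pi / 3) = sqrt 3 / 2" "sin (4 * pi / 3) = - (sqrt 3 / 2)"
  "sin (5 * pi / 3) = - (sqrt 3 / 2)"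
proof -
  have "sin (2 * pi / 3) = sin (pi - pi / 3)" by (rule arg_cong[of _ _ sin]) simp
  then show "sin (2 * pi / 3) = sqrt 3 / 2" by (simp only: sin_pi_minus sin_60)
  have "sin (4 * pi / 3) = sin (pi / 3 + pi)" by (rule arg_cong[of _ _ sin]) simp
  then show "sin (4 * pi / 3) = - (sqrt 3 / 2)" by (simp only: sin_periodic_pi sin_60)
  have "sin (5 * pi / 3) = sin (2 * pi - pi / 3)" by (rule arg_cong[of _ _ sin]) simp
  then show "sin (5 * pi / 3) = - (sqrt 3 / 2)" by (simp only: sin_2pi_minus sin_60)
qed

lemma two_cis_start_angle: "2 * cis (start_angle s) = lattice_point (start_dx s) (start_dy s)"
  by (cases s) (simp_all add: complex_eq_iff cos_60 sin_60 cos_angles sin_angles)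

lemma two_cis_end_angle:
  "2 * cis (end_angle s) = lattice_point (start_dx s + run s) (start_dy s + rise s)"
  by (cases s) (simp_all add: complex_eq_iff cos_60 sin_60 cos_angles sin_angles)

lemma pathstart_arc_from: "pathstart (arc_curve (arc_from x y s)) = lattice_point x y"
  by (simp add: pathstart_arc_curve arc_from_def two_cis_start_angle lattice_point_add)

lemma pathfinish_arc_from:
  "pathfinish (arc_curve (arc_from x y s)) = lattice_point (x + run s) (y + rise s)"
  by (simp add: pathfinish_arc_curve arc_from_def two_cis_end_angle lattice_point_add)

lemma pathstart_eq_lattice_point_iff:
  "pathstart (arc_curve a) = lattice_point x y \<longleftrightarrow> a = arc_from x y (snd a)"
proof
  assume "pathstart (arc_curve a) = lattice_point x y"
  then show "a = arc_from x y (snd a)"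
    by (simp add: pathstart_arc_curve arc_from_def two_cis_start_angle complex_eq_iff prod_eq_iff
        algebra_simps)
qed (metis pathstart_arc_from)

lemma circle_point:
  fixes \<theta> :: real
  assumes "z = lattice_point X Y + 2 * cis \<theta>"
  shows "(Re z - of_int X)\<^sup>2 + (Im z - sqrt 3 * of_int Y)\<^sup>2 = 4"
    and "0 \<le> sin \<theta> \<Longrightarrow> Im z = sqrt 3 * of_int Y + sqrt (4 - (Re z - of_int X)\<^sup>2)"
    and "sin \<theta> \<le> 0 \<Longrightarrow> Im z = sqrt 3 * of_int Y - sqrt (4 - (Re z - of_int X)\<^sup>2)"
proof -
  have "4 * (cos \<theta>)\<^sup>2 + 4 * (sin \<theta>)\<^sup>2 = 4"
    using sin_cos_squared_add[of \<theta>] by linarith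
  then show *: "(Re z - of_int X)\<^sup>2 + (Im z - sqrt 3 * of_int Y)\<^sup>2 = 4"
    using assms by (simp add: power_mult_distrib)
  then have "sqrt (4 - (Re z - of_int X)\<^sup>2) = \<bar>Im z - sqrt 3 * of_int Y\<bar>"
    by (metis add_diff_cancel_left' real_sqrt_abs)
  moreover have "Im z - sqrt 3 * of_int Y = 2 * sin \<theta>" using assms by simp
  ultimately show "0 \<le> sin \<theta> \<Longrightarrow> Im z = sqrt 3 * of_int Y + sqrt (4 - (Re z - of_int X)\<^sup>2)"
    "sin \<theta> \<le> 0 \<Longrightarrow> Im z = sqrt 3 * of_int Y - sqrt (4 - (Re z - of_int X)\<^sup>2)"
    by linarith+
qed

lemma arc_from_point:
  assumes "z \<in> path_image (arc_curve (arc_from x y s))"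
  defines "h \<equiv> sqrt (4 - (Re z - of_int (x - start_dx s))\<^sup>2)"
  shows "of_int x \<le> Re z" and "Re z \<le> of_int (x + run s)"
    and "upper s \<Longrightarrow> Im z = sqrt 3 * of_int (y - start_dy s) + h"
    and "\<not> upper s \<Longrightarrow> Im z = sqrt 3 * of_int (y - start_dy s) - h"
proof -
  obtain \<theta> where \<theta>: "\<theta> \<in> closed_segment (start_angle s) (end_angle s)"
    and z: "z = lattice_point (x - start_dx s) (y - start_dy s) + 2 * cis \<theta>"
    using assms(1) by (auto simp: arc_curve_def arc_from_def path_image_part_circlepath' cis_conv_exp)
  \<comment> \<open>Lower arcs are reflected in the horizontal diameter. All angles then lie in
    [0, pi], where the cosine is monotone and the sine is non-negative.\<close>
  define \<phi> where "\<phi> = (if upper s then \<theta> else 2 * pi - \<theta>)"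
  define \<alpha> where "\<alpha> = (if upper s then start_angle s else 2 * pi - start_angle s)"
  define \<beta> where "\<beta> = (if upper s then end_angle s else 2 * pi - end_angle s)"
  have \<phi>: "\<beta> \<le> \<phi>" "\<phi> \<le> \<alpha>" and ab: "0 \<le> \<beta>" "\<alpha> \<le> pi"
    using \<theta> pi_gt_zero
    by (cases s; simp add: \<phi>_def \<alpha>_def \<beta>_def closed_segment_eq_real_ivl split: if_splits)+
  have "cos \<alpha> \<le> cos \<phi>" "cos \<phi> \<le> cos \<beta>"
    using \<phi> ab by (auto intro!: cos_monotone_0_pi_le)
  moreover have "cos \<phi> = cos \<theta>" "cos \<alpha> = cos (start_angle s)" "cos \<beta> = cos (end_angle s)"
    by (simp_all add: \<phi>_def \<alpha>_def \<beta>_def cos_diff)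
  moreover have "2 * cos (start_angle s) = of_int (start_dx s)"
    "2 * cos (end_angle s) = of_int (start_dx s + run s)"
    using arg_cong[OF two_cis_start_angle[of s], of Re] arg_cong[OF two_cis_end_angle[of s], of Re]
    by simp_all
  ultimately show "of_int x \<le> Re z" "Re z \<le> of_int (x + run s)"
    by (auto simp: z)
  have sin: "0 \<le> sin \<phi>" using \<phi> ab by (intro sin_ge_zero) auto
  show "Im z = sqrt 3 * of_int (y - start_dy s) + h" if "upper s"
    unfolding h_def using sin that by (intro circle_point(2)[OF z]) (simp add: \<phi>_def)
  show "Im z = sqrt 3 * of_int (y - start_dy s) - h" if "\<not> upper s"
    unfolding h_def using sin that by (intro circle_point(3)[OF z]) (simp add: \<phi>_def sin_diff)
qed

lemma arc_from_point_at_ends: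
  assumes "z \<in> path_image (arc_curve (arc_from x y s))"
  shows "Re z = of_int x \<Longrightarrow> Im z = sqrt 3 * of_int y"
    and "Re z = of_int (x + run s) \<Longrightarrow> Im z = sqrt 3 * of_int (y + rise s)"
  using arc_from_point(3,4)[OF assms] by (cases s; simp add: algebra_simps)+


section \<open>Paths as words\<close>

fun arcs_from :: "int \<Rightarrow> int \<Rightarrow> step list \<Rightarrow> circle_arc list" where
  "arcs_from x y [] = []"
| "arcs_from x y (s # w) = arc_from x y s # arcs_from (x + run s) (y + rise s) w"

fun vertices :: "int \<Rightarrow> int \<Rightarrow> step list \<Rightarrow> (int \<times> int) set" where
  "vertices x y [] = {(x, y)}"
| "vertices x y (s # w) = insert (x, y) (vertices (x + run s) (y + rise s) w)"

text \<open>Which step may follow which is encoded by this condition alone: every arc must lie on a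
  circle of the packing.\<close>

fun centers_ok :: "int \<Rightarrow> int \<Rightarrow> step list \<Rightarrow> bool" where
  "centers_ok x y [] = True"
| "centers_ok x y (s # w) \<longleftrightarrow> center_from x y s \<and> centers_ok (x + run s) (y + rise s) w"

definition total_rise :: "step list \<Rightarrow> int" where
  "total_rise w = sum_list (map rise w)"

lemma word_width_simps [simp]:
  "word_width [] = 0" "word_width (s # w) = step_width s + word_width w"
  by (simp_all add: word_width_def)

lemma total_rise_simps [simp]:
  "total_rise [] = 0" "total_rise (s # w) = rise s + total_rise w"
  by (simp_all add: total_rise_def)

lemma run_pos: "0 < run s"
  by (cases s) auto

lemma map_snd_arcs_from [simp]: "map snd (arcs_from x y w) = w"
  by (induction w arbitrary: x y) (simp_all add: arc_from_def)

lemma arcs_from_eq_Nil_iff [simp]: "arcs_from x y w = [] \<longleftrightarrow> w = []"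
  by (cases w) auto

text \<open>The type of an arc fixes the offset from its centre to its initial point, so a chain is
  determined by its start and its types; the centres carry the remaining condition.\<close>

lemma arcs_from_iff:
  "fst ` set P \<subseteq> packing_centers \<and>
     (P \<noteq> [] \<longrightarrow> pathstart (arc_curve (hd P)) = lattice_point x y) \<and>
     successively (\<lambda>a b. pathfinish (arc_curve a) = pathstart (arc_curve b)) P \<longleftrightarrow>
   P = arcs_from x y (map snd P) \<and> centers_ok x y (map snd P)"
proof (induction P arbitrary: x y)
  case Nil
  then show ?case by simp
next
  case (Cons a P)
  define s where "s = snd a"
  have center: "fst (arc_from x y s) \<in> packing_centers \<longleftrightarrow> center_from x y s"
    by (auto simp: arc_from_def packing_centers_eq)
  show ?case
  proof (cases "a = arc_from x y s")
    case True
    have "snd (arc_from x y s) = s" by (simp add: arc_from_def)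
    then show ?thesis
      unfolding True using Cons.IH[of "x + run s" "y + rise s"] center
      by (auto simp: successively_Cons pathstart_arc_from pathfinish_arc_from)
  next
    case False
    then show ?thesis
      by (auto simp: s_def pathstart_eq_lattice_point_iff)
  qed
qed

lemma pathfinish_last_arcs_from:
  "w \<noteq> [] \<Longrightarrow> pathfinish (arc_curve (last (arcs_from x y w))) =
     lattice_point (x + int (word_width w)) (y + total_rise w)"
proof (induction w arbitrary: x y)
  case (Cons s w)
  then show ?case
    by (cases "w = []") (simp_all add: pathfinish_arc_from add.assoc)
qed simp

lemma endpoint_arcs_from:
  "endpoint (arcs_from 0 0 w) = lattice_point (int (word_width w)) (total_rise w)"
  using pathfinish_last_arcs_from[of w 0 0] by (auto simp: endpoint_def lattice_point_0)

lemma start_in_vertices: "(x, y) \<in> vertices x y w"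
  by (cases w) auto

lemma vertices_from_start: "(u, v) \<in> vertices x y w \<Longrightarrow> (u, v) = (x, y) \<or> x < u"
proof (induction w arbitrary: x y)
  case (Cons s w)
  from Cons.prems consider "(u, v) = (x, y)" | "(u, v) \<in> vertices (x + run s) (y + rise s) w"
    by auto
  then show ?case
  proof cases
    case 2
    then have "x + run s \<le> u" using Cons.IH by fastforce
    then show ?thesis using run_pos[of s] by linarith
  qed simp
qed simp

lemma vertices_to_end:
  "(u, v) \<in> vertices x y w \<Longrightarrow>
     (u, v) = (x + int (word_width w), y + total_rise w) \<or> u < x + int (word_width w)"
proof (induction w arbitrary: x y)
  case (Cons s w)
  from Cons.prems consider "(u, v) = (x, y)" | "(u, v) \<in> vertices (x + run s) (y + rise s) w"
    by auto
  then show ?case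
  proof cases
    case 1
    then show ?thesis using run_pos[of s] by simp
  next
    case 2
    then show ?thesis using Cons.IH[OF 2] by (simp add: add.assoc)
  qed
qed simp

lemma arc_in_arcs_from:
  "a \<in> set (arcs_from x y w) \<Longrightarrow> centers_ok x y w \<Longrightarrow>
     \<exists>u v s. a = arc_from u v s \<and> center_from u v s \<and> (u, v) \<in> vertices x y w \<and>
       (u + run s, v + rise s) \<in> vertices x y w"
proof (induction w arbitrary: x y)
  case (Cons s w)
  show ?case
  proof (cases "a = arc_from x y s")
    case True
    then show ?thesis using Cons.prems start_in_vertices by fastforce
  next
    case False
    then have "a \<in> set (arcs_from (x + run s) (y + rise s) w)" using Cons.prems by simp
    then show ?thesis using Cons.IH[of "x + run s" "y + rise s"] Cons.prems by fastforce
  qed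
qed simp

lemma vertex_on_arc:
  "(u, v) \<in> vertices x y w \<Longrightarrow> (u, v) = (x, y) \<or>
     (\<exists>a\<in>set (arcs_from x y w). lattice_point u v \<in> path_image (arc_curve a))"
proof (induction w arbitrary: x y)
  case (Cons s w)
  have "lattice_point (x + run s) (y + rise s) \<in> path_image (arc_curve (arc_from x y s))"
    by (metis pathfinish_arc_from pathfinish_in_path_image)
  then show ?case
    using Cons.prems Cons.IH[of "x + run s" "y + rise s"] by auto
qed simp

lemma vertex_in_trace:
  "(u, v) \<in> vertices 0 0 w \<Longrightarrow> lattice_point u v \<in> path_trace (arcs_from 0 0 w)"
  using vertex_on_arc[of u v 0 0 w] by (auto simp: path_trace_def lattice_point_0)

text \<open>The sign at the two ends of an arc controls the whole arc: an upper arc lies above its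
  centre, whose row is non-negative, and the centre of a lower arc is at height at least
  \<open>2 * sqrt 3\<close>, more than the radius.\<close>

lemma trace_nonneg_iff:
  assumes "centers_ok 0 0 w"
  shows "path_trace (arcs_from 0 0 w) \<subseteq> {z. 0 \<le> Re z \<and> 0 \<le> Im z} \<longleftrightarrow>
    (\<forall>(u, v)\<in>vertices 0 0 w. 0 \<le> v)"
proof
  assume L: "path_trace (arcs_from 0 0 w) \<subseteq> {z. 0 \<le> Re z \<and> 0 \<le> Im z}"
  show "\<forall>(u, v)\<in>vertices 0 0 w. 0 \<le> v"
  proof clarify
    fix u v assume "(u, v) \<in> vertices 0 0 w"
    then have "0 \<le> Im (lattice_point u v)" using vertex_in_trace L by blast
    then show "0 \<le> v" by (simp add: zero_le_mult_iff)
  qed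
next
  assume R: "\<forall>(u, v)\<in>vertices 0 0 w. 0 \<le> v"
  have "0 \<le> Re z \<and> 0 \<le> Im z" if "z \<in> path_trace (arcs_from 0 0 w)" for z
  proof (cases "z = 0")
    case False
    then obtain a where a: "a \<in> set (arcs_from 0 0 w)" "z \<in> path_image (arc_curve a)"
      using \<open>z \<in> path_trace _\<close> by (auto simp: path_trace_def)
    then obtain u v s where uv: "a = arc_from u v s" "center_from u v s"
      "(u, v) \<in> vertices 0 0 w" "(u + run s, v + rise s) \<in> vertices 0 0 w"
      using arc_in_arcs_from assms by blast
    note z = arc_from_point[OF a(2)[unfolded uv(1)]]
    have "0 \<le> u" using vertices_from_start[OF uv(3)] by auto
    then have "0 \<le> Re z" using z(1) by linarith
    define Y where "Y = v - start_dy s"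
    define h where "h = sqrt (4 - (Re z - of_int (u - start_dx s))\<^sup>2)"
    have "0 \<le> v" "0 \<le> v + rise s" using R uv by auto
    \<comment> \<open>A lower arc has an end at height \<open>Y - 1\<close>, and \<open>Y\<close> is
      even, so non-negativity there gives \<open>2 \<le> Y\<close>.\<close>
    then have Y: "0 \<le> Y" "\<not> upper s \<Longrightarrow> 2 \<le> Y"
      using uv(2) unfolding Y_def by (cases s; simp add: is_center_def; presburger)+
    have "(Re z - of_int (u - start_dx s))\<^sup>2 \<le> 4"
      using z(1,2) by (cases s) (auto simp: abs_square_le_1 intro!: abs_le_square_iff[THEN iffD1, of _ 2, simplified])
    then have h: "0 \<le> h" "h \<le> 2"
      by (auto simp: h_def intro!: real_le_lsqrt)
    have "0 \<le> Im z"
    proof (cases "upper s")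
      case True
      then show ?thesis using z(3) Y(1) h by (simp add: Y_def h_def)
    next
      case False
      have "1 \<le> sqrt 3" by simp
      moreover have "sqrt 3 * 2 \<le> sqrt 3 * of_int Y" using Y(2)[OF False] by simp
      ultimately show ?thesis using z(4)[OF False, folded Y_def h_def] h by linarith
    qed
    then show ?thesis using \<open>0 \<le> Re z\<close> by simp
  qed simp
  then show "path_trace (arcs_from 0 0 w) \<subseteq> {z. 0 \<le> Re z \<and> 0 \<le> Im z}" by blast
qed

text \<open>\<open>Pole\<close> and \<open>Summit\<close> describe the same points: they differ in
  the last step, not in position.\<close>

fun located :: "kind \<times> nat \<Rightarrow> int \<Rightarrow> int \<Rightarrow> bool" where
  "located (Pole, m) x y \<longleftrightarrow> y = 2 * int m \<and> 4 dvd x - y"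
| "located (Summit, m) x y \<longleftrightarrow> y = 2 * int m \<and> 4 dvd x - y"
| "located (Lft, m) x y \<longleftrightarrow> y = 2 * int m + 1 \<and> 4 dvd x - y"
| "located (Rgt, m) x y \<longleftrightarrow> y = 2 * int m + 1 \<and> 4 dvd x - y - 2"

text \<open>The residues modulo 4 decide which arcs start at a tangency point. The table is exact:
  its missing entries are the steps that leave the packing or go below the axis.\<close>

lemma next_state_located:
  assumes "located \<sigma> x y"
  shows "case next_state \<sigma> s of None \<Rightarrow> \<not> (center_from x y s \<and> 0 \<le> y + rise s)
    | Some \<tau> \<Rightarrow> center_from x y s \<and> 0 \<le> y + rise s \<and> located \<tau> (x + run s) (y + rise s)"
proof -
  obtain k m where \<sigma>: "\<sigma> = (k, m)" by fastforce
  show ?thesis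
    using assms unfolding \<sigma>
    by (cases k; cases m; cases s; simp add: is_center_def; presburger)
qed

lemma accepts_iff:
  "located \<sigma> x y \<Longrightarrow> accepts \<sigma> w \<longleftrightarrow>
     centers_ok x y w \<and> (\<forall>(u, v)\<in>vertices x y w. 0 \<le> v) \<and> y + total_rise w = 0"
proof (induction w arbitrary: \<sigma> x y)
  case Nil
  obtain k m where "\<sigma> = (k, m)" by fastforce
  with Nil show ?case by (cases k) (auto simp: final_state_def)
next
  case (Cons s w)
  have y: "0 \<le> y"
  proof -
    obtain k m where "\<sigma> = (k, m)" by fastforce
    with Cons.prems show ?thesis by (cases k) auto
  qed
  show ?case
  proof (cases "next_state \<sigma> s")
    case None
    then have "\<not> (center_from x y s \<and> 0 \<le> y + rise s)"
      using next_state_located[OF Cons.prems, of s] by simp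
    then show ?thesis
      using None start_in_vertices[of "x + run s" "y + rise s" w] by auto
  next
    case (Some \<tau>)
    then have "center_from x y s" "located \<tau> (x + run s) (y + rise s)"
      using next_state_located[OF Cons.prems, of s] by auto
    then show ?thesis
      using Some y Cons.IH[of \<tau> "x + run s" "y + rise s"] by (simp add: add.assoc)
  qed
qed

lemma located_origin: "located (Pole, 0) 0 0"
  by simp

lemma packing_path_iff:
  "packing_path P \<longleftrightarrow> (\<exists>w. accepts (Pole, 0) w \<and> P = arcs_from 0 0 w)"
proof -
  have "packing_path P \<longleftrightarrow> P = arcs_from 0 0 (map snd P) \<and> centers_ok 0 0 (map snd P) \<and>
      path_trace P \<subseteq> {z. 0 \<le> Re z \<and> 0 \<le> Im z} \<and> Im (endpoint P) = 0"
    using arcs_from_iff[of P 0 0]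
    by (simp only: packing_path_def path_in_packing_def lattice_point_0) blast
  also have "\<dots> \<longleftrightarrow> (\<exists>w. P = arcs_from 0 0 w \<and> centers_ok 0 0 w \<and>
      path_trace P \<subseteq> {z. 0 \<le> Re z \<and> 0 \<le> Im z} \<and> Im (endpoint P) = 0)"
    by (metis map_snd_arcs_from)
  also have "\<dots> \<longleftrightarrow> (\<exists>w. accepts (Pole, 0) w \<and> P = arcs_from 0 0 w)"
    using trace_nonneg_iff by (auto simp: accepts_iff[OF located_origin] endpoint_arcs_from)
  finally show ?thesis .
qed


section \<open>Kissing circles\<close>

text \<open>A vertex is clear of a circle if it is not below it. The parity of the coordinates excludes
  a vertex at the level of the centre strictly between the extreme abscissas, and any vertex strictly
  between them that lies above the centre forces all other vertices of the path to be clear.\<close>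

definition clear :: "int \<Rightarrow> int \<Rightarrow> int \<times> int \<Rightarrow> bool" where
  "clear X Y p \<longleftrightarrow>
     (\<bar>fst p - X\<bar> < 2 \<longrightarrow> Y < snd p) \<and> (\<bar>fst p - X\<bar> \<le> 2 \<longrightarrow> Y \<le> snd p)"

text \<open>Circles of the packing do not overlap, so a single arc cannot lead from strictly above a
  circle to below it; on integer coordinates this is a finite check of residues.\<close>

lemma clear_step:
  assumes "is_center X Y" "center_from x y s"
  shows "\<bar>x - X\<bar> < 2 \<Longrightarrow> Y < y \<Longrightarrow> clear X Y (x + run s, y + rise s)"
    and "\<bar>x + run s - X\<bar> < 2 \<Longrightarrow> Y < y + rise s \<Longrightarrow> clear X Y (x, y)"
  using assms by (cases s; simp add: clear_def is_center_def; presburger)+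

lemma clear_forward:
  "is_center X Y \<Longrightarrow> centers_ok x y w \<Longrightarrow> \<bar>x - X\<bar> < 2 \<Longrightarrow> Y < y \<Longrightarrow>
     (u, v) \<in> vertices x y w \<Longrightarrow> clear X Y (u, v)"
proof (induction w arbitrary: x y)
  case Nil
  then show ?case by (simp add: clear_def)
next
  case (Cons s w)
  let ?x = "x + run s" and ?y = "y + rise s"
  have ok: "centers_ok ?x ?y w" and step: "clear X Y (?x, ?y)"
    using Cons.prems clear_step(1) by auto
  from Cons.prems consider "(u, v) = (x, y)" | "(u, v) \<in> vertices ?x ?y w" by auto
  then show ?case
  proof cases
    case 1
    then show ?thesis using Cons.prems by (simp add: clear_def)
  next
    case 2
    show ?thesis
    proof (cases "\<bar>?x - X\<bar> < 2")
      case True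
      then have "Y < ?y" using step by (simp add: clear_def)
      then show ?thesis by (rule Cons.IH[OF Cons.prems(1) ok True _ 2])
    next
      case False
      \<comment> \<open>The path has left the open span of the circle on the right at a clear
        vertex, and all later vertices are outside the closed span.\<close>
      then have "X + 2 \<le> ?x" using Cons.prems(3) run_pos[of s] by linarith
      moreover have "(u, v) = (?x, ?y) \<or> ?x < u" using vertices_from_start[OF 2] .
      ultimately show ?thesis using step by (auto simp: clear_def)
    qed
  qed
qed

text \<open>Mirror image of \<open>clear_forward\<close>. It concerns the start only, because
  \<open>all_clear\<close> moves the start along the word.\<close>

lemma clear_backward:
  "is_center X Y \<Longrightarrow> centers_ok x y w \<Longrightarrow> (u, v) \<in> vertices x y w \<Longrightarrow>
     \<bar>u - X\<bar> < 2 \<Longrightarrow> Y < v \<Longrightarrow> clear X Y (x, y)"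
proof (induction w arbitrary: x y)
  case Nil
  then show ?case by (simp add: clear_def)
next
  case (Cons s w)
  let ?x = "x + run s" and ?y = "y + rise s"
  from Cons.prems consider "(u, v) = (x, y)" | "(u, v) \<in> vertices ?x ?y w" by auto
  then show ?case
  proof cases
    case 1
    then show ?thesis using Cons.prems by (simp add: clear_def)
  next
    case 2
    have "center_from x y s" and ok: "centers_ok ?x ?y w" using Cons.prems by auto
    have next_clear: "clear X Y (?x, ?y)"
      by (rule Cons.IH[OF Cons.prems(1) ok 2 Cons.prems(4,5)])
    have "?x \<le> u" using vertices_from_start[OF 2] by auto
    show ?thesis
    proof (cases "\<bar>?x - X\<bar> < 2")
      case True
      then have "Y < ?y" using next_clear by (simp add: clear_def)
      then show ?thesis
        using clear_step(2) Cons.prems(1) \<open>center_from x y s\<close> True by blast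
    next
      case False
      then have "x < X - 2" using \<open>?x \<le> u\<close> Cons.prems(4) run_pos[of s] by linarith
      then show ?thesis by (simp add: clear_def)
    qed
  qed
qed

text \<open>Steps are peeled off until one of the two vertices is the start; then
  \<open>clear_forward\<close> or \<open>clear_backward\<close> applies.\<close>

lemma all_clear:
  "is_center X Y \<Longrightarrow> centers_ok x y w \<Longrightarrow> (u, v) \<in> vertices x y w \<Longrightarrow>
     \<bar>u - X\<bar> < 2 \<Longrightarrow> Y < v \<Longrightarrow> (u', v') \<in> vertices x y w \<Longrightarrow> clear X Y (u', v')"
proof (induction w arbitrary: x y)
  case Nil
  then show ?case by (simp add: clear_def)
next
  case (Cons s w)
  let ?x = "x + run s" and ?y = "y + rise s"
  show ?case
  proof (cases "(u', v') = (x, y)")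
    case True
    then show ?thesis using clear_backward Cons.prems by blast
  next
    case False
    show ?thesis
    proof (cases "(u, v) = (x, y)")
      case True
      then show ?thesis using clear_forward Cons.prems by blast
    next
      case outer: False
      then have "(u, v) \<in> vertices ?x ?y w" "(u', v') \<in> vertices ?x ?y w" "centers_ok ?x ?y w"
        using False Cons.prems by auto
      then show ?thesis using Cons.IH Cons.prems(1,4,5) by blast
    qed
  qed
qed

text \<open>The four tangency points on the upper half of the circle, ends of the horizontal
  diameter included.\<close>

definition contacts :: "int \<Rightarrow> int \<Rightarrow> (int \<times> int) set" where
  "contacts X Y = {(X - 1, Y + 1), (X + 1, Y + 1), (X - 2, Y), (X + 2, Y)}"

text \<open>Compares the upper half of a circle with the lower half of its upper right neighbour,
  which meet only midway between the centres. By the parallelogram identity the square of the sum is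
  \<open>12 - 4 * (t - 1)\<^sup>2\<close> minus the square of the difference.\<close>

lemma sqrt_add_sqrt_le:
  fixes t :: real
  assumes "\<bar>t\<bar> \<le> 2" "\<bar>t - 2\<bar> \<le> 2"
  shows "sqrt (4 - t\<^sup>2) + sqrt (4 - (t - 2)\<^sup>2) \<le> 2 * sqrt 3"
    and "sqrt (4 - t\<^sup>2) + sqrt (4 - (t - 2)\<^sup>2) = 2 * sqrt 3 \<Longrightarrow> t = 1"
proof -
  let ?a = "sqrt (4 - t\<^sup>2)" and ?b = "sqrt (4 - (t - 2)\<^sup>2)"
  have "t\<^sup>2 \<le> 2\<^sup>2" "(t - 2)\<^sup>2 \<le> 2\<^sup>2"
    using assms by (simp_all only: abs_le_square_iff[symmetric])
  then have sq: "?a\<^sup>2 = 4 - t\<^sup>2" "?b\<^sup>2 = 4 - (t - 2)\<^sup>2" by simp_all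
  have "(?a + ?b)\<^sup>2 + (?a - ?b)\<^sup>2 = 2 * (?a\<^sup>2 + ?b\<^sup>2)"
    by (simp add: power2_eq_square algebra_simps)
  also have "\<dots> = 12 - 4 * (t - 1)\<^sup>2"
    unfolding sq by (simp add: power2_eq_square algebra_simps)
  finally have *: "(?a + ?b)\<^sup>2 = 12 - 4 * (t - 1)\<^sup>2 - (?a - ?b)\<^sup>2" by simp
  have twelve: "(2 * sqrt 3)\<^sup>2 = 12" by (simp add: power_mult_distrib)
  have "(?a + ?b)\<^sup>2 \<le> (2 * sqrt 3)\<^sup>2" unfolding twelve * using zero_le_power2[of "t - 1"] zero_le_power2[of "?a - ?b"] by linarith
  then show "?a + ?b \<le> 2 * sqrt 3" by (rule power2_le_imp_le) simp
  show "t = 1" if "?a + ?b = 2 * sqrt 3"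
  proof -
    have "4 * (t - 1)\<^sup>2 + (?a - ?b)\<^sup>2 = 0" using * twelve that by simp
    then have "(t - 1)\<^sup>2 = 0" using zero_le_power2[of "t - 1"] zero_le_power2[of "?a - ?b"] by linarith
    then show ?thesis by simp
  qed
qed

text \<open>Centres in one row are 4 apart and adjacent rows are shifted by 2. Hence a lower arc
  from row \<open>Y + 2\<close> over the open span lies on one of the two upper neighbours, and an
  upper arc from row \<open>Y\<close> there lies on the circle itself.\<close>

lemma arc_position_cases:
  assumes "is_center X Y" "center_from x y s" "clear X Y (x, y)" "clear X Y (x + run s, y + rise s)"
  obtains (right) "X + 2 \<le> x" | (left) "x + run s \<le> X - 2"
    | (upper_far) "upper s" "Y + 2 \<le> y - start_dy s"
    | (same) "upper s" "x - start_dx s = X" "y - start_dy s = Y"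
    | (lower_far) "\<not> upper s" "Y + 4 \<le> y - start_dy s"
    | (lower_right) "\<not> upper s" "x - start_dx s = X + 2" "y - start_dy s = Y + 2"
    | (lower_left) "\<not> upper s" "x - start_dx s = X - 2" "y - start_dy s = Y + 2"
proof -
  have "X + 2 \<le> x \<or> x + run s \<le> X - 2 \<or> (upper s \<and> Y + 2 \<le> y - start_dy s) \<or>
      (upper s \<and> x - start_dx s = X \<and> y - start_dy s = Y) \<or>
      (\<not> upper s \<and> Y + 4 \<le> y - start_dy s) \<or>
      (\<not> upper s \<and> x - start_dx s = X + 2 \<and> y - start_dy s = Y + 2) \<or>
      (\<not> upper s \<and> x - start_dx s = X - 2 \<and> y - start_dy s = Y + 2)"
    using assms by (cases s; simp add: clear_def is_center_def; presburger)
  then show ?thesis using that by blast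
qed

text \<open>Far arcs are strictly higher because a row gap of \<open>2 * sqrt 3\<close> exceeds 2
  and one of \<open>4 * sqrt 3\<close> exceeds 4; lateral arcs share at most one abscissa with the
  circle; the upper neighbours are settled by \<open>sqrt_add_sqrt_le\<close>.\<close>

lemma arc_clear:
  assumes centers: "is_center X Y" "center_from x y s"
    and clear: "clear X Y (x, y)" "clear X Y (x + run s, y + rise s)"
    and z: "z \<in> path_image (arc_curve (arc_from x y s))" and range: "\<bar>Re z - of_int X\<bar> \<le> 2"
  defines "arch \<equiv> sqrt 3 * of_int Y + sqrt (4 - (Re z - of_int X)\<^sup>2)"
  shows "arch \<le> Im z"
    and "Im z = arch \<Longrightarrow> (x, y) \<in> contacts X Y \<or> (x + run s, y + rise s) \<in> contacts X Y"
proof -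
  define X' where "X' = x - start_dx s"
  define Y' where "Y' = y - start_dy s"
  define h where "h = sqrt (4 - (Re z - of_int X)\<^sup>2)"
  define h' where "h' = sqrt (4 - (Re z - of_int X')\<^sup>2)"
  note point = arc_from_point[OF z, folded X'_def Y'_def, folded h'_def]
  have arch: "arch = sqrt 3 * of_int Y + h" by (simp add: arch_def h_def)
  have range': "\<bar>Re z - of_int X'\<bar> \<le> 2"
    using point(1,2) unfolding X'_def by (cases s) auto
  have bound: "0 \<le> sqrt (4 - (t::real)\<^sup>2) \<and> sqrt (4 - t\<^sup>2) \<le> 2" if "\<bar>t\<bar> \<le> 2" for t
  proof -
    have "t\<^sup>2 \<le> 2\<^sup>2" using that by (simp only: abs_le_square_iff[symmetric])
    then show ?thesis by (auto intro!: real_le_lsqrt)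
  qed
  have h: "0 \<le> h" "h \<le> 2" "0 \<le> h'" "h' \<le> 2"
    using bound range range' by (auto simp: h_def h'_def)
  have sqrt3: "1 < sqrt 3" by simp
  have row: "sqrt 3 * of_int Y + k * sqrt 3 \<le> sqrt 3 * of_int Y'" if "of_int Y + k \<le> of_int Y'" for k
  proof -
    have "(of_int Y + k) * sqrt 3 \<le> of_int Y' * sqrt 3"
      using that by (intro mult_right_mono) auto
    then show ?thesis by (simp only: distrib_right mult.commute)
  qed
  have "arch \<le> Im z \<and> (Im z = arch \<longrightarrow>
      (x, y) \<in> contacts X Y \<or> (x + run s, y + rise s) \<in> contacts X Y)"
    using centers clear
  proof (cases rule: arc_position_cases)
    case right
    then have x: "Re z = of_int x" "x = X + 2" using point(1) range by linarith+
    have "Im z = sqrt 3 * of_int y" using arc_from_point_at_ends(1)[OF z] x by simp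
    moreover have "h = 0" using x by (simp add: h_def)
    moreover have "Y \<le> y" using clear(1) x by (simp add: clear_def)
    ultimately show ?thesis using x by (simp add: arch contacts_def)
  next
    case left
    then have x: "Re z = of_int (x + run s)" "x + run s = X - 2" using point(2) range by linarith+
    have "Im z = sqrt 3 * of_int (y + rise s)" using arc_from_point_at_ends(2)[OF z] x by simp
    moreover have "h = 0" using x by (simp add: h_def)
    moreover have "Y \<le> y + rise s" using clear(2) x by (simp add: clear_def)
    ultimately show ?thesis using x by (simp add: arch contacts_def)
  next
    case upper_far
    then have "sqrt 3 * of_int Y + 2 * sqrt 3 \<le> sqrt 3 * of_int Y'"
      by (intro row) (simp add: Y'_def)
    then have "arch < Im z" using point(3) upper_far(1) h sqrt3 unfolding arch by linarith
    then show ?thesis by simp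
  next
    case same
    then have "X' = X" "Y' = Y" by (simp_all add: X'_def Y'_def)
    then have "Im z = arch" using point(3) same(1) by (simp add: arch h_def h'_def)
    moreover have "(x, y) \<in> contacts X Y \<or> (x + run s, y + rise s) \<in> contacts X Y"
      using same by (cases s) (auto simp: contacts_def)
    ultimately show ?thesis by simp
  next
    case lower_far
    then have "sqrt 3 * of_int Y + 4 * sqrt 3 \<le> sqrt 3 * of_int Y'"
      by (intro row) (simp add: Y'_def)
    then have "arch < Im z" using point(4) lower_far(1) h sqrt3 unfolding arch by linarith
    then show ?thesis by simp
  next
    case lower_right
    define t where "t = Re z - of_int X"
    have X': "X' = X + 2" and Y': "Y' = Y + 2"
      using lower_right by (simp_all add: X'_def Y'_def)
    have sub: "Re z - of_int X' = t - 2" by (simp add: t_def X')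
    have t: "\<bar>t\<bar> \<le> 2" "\<bar>t - 2\<bar> \<le> 2" "h = sqrt (4 - t\<^sup>2)" "h' = sqrt (4 - (t - 2)\<^sup>2)"
      using range range' unfolding h_def h'_def sub by (simp_all add: t_def)
    have Im: "Im z = sqrt 3 * of_int Y + 2 * sqrt 3 - h'"
      using point(4) lower_right(1) by (simp add: Y' distrib_left)
    have "arch \<le> Im z"
      using sqrt_add_sqrt_le(1)[OF t(1,2)] unfolding Im arch t(3,4) by linarith
    moreover have "(x, y) \<in> contacts X Y \<or> (x + run s, y + rise s) \<in> contacts X Y" if "Im z = arch"
    proof -
      have "t = 1"
        using that unfolding Im arch t(3,4) by (intro sqrt_add_sqrt_le(2)[OF t(1,2)]) linarith
      then have "Re z = of_int (X + 1)" by (simp add: t_def)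
      \<comment> \<open>The tangency point is one of the points that cut the neighbour into arcs, so
        an arc containing it has it as an end.\<close>
      then have "x \<le> X + 1" "X + 1 \<le> x + run s" using point(1,2) by linarith+
      then show ?thesis using lower_right by (cases s) (auto simp: contacts_def)
    qed
    ultimately show ?thesis by simp
  next
    case lower_left
    \<comment> \<open>The abscissa is reflected so that the left neighbour satisfies the same
      inequality.\<close>
    define t where "t = of_int X - Re z"
    have X': "X' = X - 2" and Y': "Y' = Y + 2"
      using lower_left by (simp_all add: X'_def Y'_def)
    have sub: "Re z - of_int X' = - (t - 2)" "Re z - of_int X = - t" by (simp_all add: t_def X')
    have t: "\<bar>t\<bar> \<le> 2" "\<bar>t - 2\<bar> \<le> 2" "h = sqrt (4 - t\<^sup>2)" "h' = sqrt (4 - (t - 2)\<^sup>2)"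
      using range range' unfolding h_def h'_def sub by (simp_all only: abs_minus_cancel power2_minus)
    have Im: "Im z = sqrt 3 * of_int Y + 2 * sqrt 3 - h'"
      using point(4) lower_left(1) by (simp add: Y' distrib_left)
    have "arch \<le> Im z"
      using sqrt_add_sqrt_le(1)[OF t(1,2)] unfolding Im arch t(3,4) by linarith
    moreover have "(x, y) \<in> contacts X Y \<or> (x + run s, y + rise s) \<in> contacts X Y" if "Im z = arch"
    proof -
      have "t = 1"
        using that unfolding Im arch t(3,4) by (intro sqrt_add_sqrt_le(2)[OF t(1,2)]) linarith
      then have "Re z = of_int (X - 1)" by (simp add: t_def)
      then have "x \<le> X - 1" "X - 1 \<le> x + run s" using point(1,2) by linarith+
      then show ?thesis using lower_left by (cases s) (auto simp: contacts_def)
    qed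
    ultimately show ?thesis by simp
  qed
  then show "arch \<le> Im z"
    "Im z = arch \<Longrightarrow> (x, y) \<in> contacts X Y \<or> (x + run s, y + rise s) \<in> contacts X Y"
    by blast+
qed

lemma trace_clear:
  assumes centers: "is_center X Y" "centers_ok 0 0 w" and "0 \<le> Y"
    and clear: "\<forall>p\<in>vertices 0 0 w. clear X Y p"
    and z: "z \<in> path_trace (arcs_from 0 0 w)" and range: "\<bar>Re z - of_int X\<bar> \<le> 2"
  defines "arch \<equiv> sqrt 3 * of_int Y + sqrt (4 - (Re z - of_int X)\<^sup>2)"
  shows "arch \<le> Im z" and "Im z = arch \<Longrightarrow> vertices 0 0 w \<inter> contacts X Y \<noteq> {}"
proof -
  have "arch \<le> Im z \<and> (Im z = arch \<longrightarrow> vertices 0 0 w \<inter> contacts X Y \<noteq> {})"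
  proof (cases "z = 0")
    case True
    have origin: "(0, 0) \<in> vertices 0 0 w" by (rule start_in_vertices)
    have "\<bar>X\<bar> \<le> 2" using range True by simp
    \<comment> \<open>The origin belongs to every trace, even the empty one. As a clear vertex
      within the closed span it can only be an end of the horizontal diameter.\<close>
    then have "(X = 2 \<or> X = - 2) \<and> Y = 0" using bspec[OF clear origin] \<open>0 \<le> Y\<close> by (auto simp: clear_def)
    then have "(0, 0) \<in> contacts X Y" "arch = 0" using True by (auto simp: contacts_def arch_def)
    then show ?thesis using origin True by auto
  next
    case False
    then obtain a where a: "a \<in> set (arcs_from 0 0 w)" "z \<in> path_image (arc_curve a)"
      using z by (auto simp: path_trace_def)
    then obtain u v s where uv: "a = arc_from u v s" "center_from u v s"
      "(u, v) \<in> vertices 0 0 w" "(u + run s, v + rise s) \<in> vertices 0 0 w"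
      using arc_in_arcs_from centers(2) by blast
    show ?thesis
      using arc_clear[OF centers(1) uv(2) bspec[OF clear uv(3)] bspec[OF clear uv(4)]
          a(2)[unfolded uv(1)] range]
        uv(3,4) unfolding arch_def by blast
  qed
  then show "arch \<le> Im z" "Im z = arch \<Longrightarrow> vertices 0 0 w \<inter> contacts X Y \<noteq> {}" by blast+
qed

text \<open>The step arriving at the right end of the diameter is \<open>Down\<close> on the circle
  itself, since \<open>Up_bar\<close> would start below the circle. The bound on \<open>x\<close>
  guarantees such a step.\<close>

lemma contact_on_right:
  "is_center X Y \<Longrightarrow> centers_ok x y w \<Longrightarrow> (X + 2, Y) \<in> vertices x y w \<Longrightarrow> x < X + 2 \<Longrightarrow>
     \<forall>p\<in>vertices x y w. clear X Y p \<Longrightarrow> (X + 1, Y + 1) \<in> vertices x y w"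
proof (induction w arbitrary: x y)
  case (Cons s w)
  let ?x = "x + run s" and ?y = "y + rise s"
  have in_tail: "(X + 2, Y) \<in> vertices ?x ?y w" using Cons.prems(3,4) by auto
  show ?case
  proof (cases "(X + 2, Y) = (?x, ?y)")
    case True
    moreover have "center_from x y s" using Cons.prems(2) by simp
    moreover have "clear X Y (x, y)" using Cons.prems(5) by simp
    ultimately have "(x, y) = (X + 1, Y + 1)"
      using Cons.prems(1) by (cases s; simp add: clear_def is_center_def; presburger)
    then show ?thesis by simp
  next
    case False
    then have "?x < X + 2" using vertices_from_start[OF in_tail] by auto
    then have "(X + 1, Y + 1) \<in> vertices ?x ?y w"
      using Cons.prems by (intro Cons.IH in_tail) auto
    then show ?thesis by simp
  qed
qed simp

text \<open>Mirror image of \<open>contact_on_right\<close>; the width hypothesis guarantees a step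
  leaving the left end of the diameter.\<close>

lemma contact_on_left:
  "is_center X Y \<Longrightarrow> centers_ok x y w \<Longrightarrow> (X - 2, Y) \<in> vertices x y w \<Longrightarrow>
     X - 2 < x + int (word_width w) \<Longrightarrow>
     \<forall>p\<in>vertices x y w. clear X Y p \<Longrightarrow> (X - 1, Y + 1) \<in> vertices x y w"
proof (induction w arbitrary: x y)
  case (Cons s w)
  let ?x = "x + run s" and ?y = "y + rise s"
  show ?case
  proof (cases "(X - 2, Y) = (x, y)")
    case True
    moreover have "center_from x y s" using Cons.prems(2) by simp
    moreover have "clear X Y (?x, ?y)" using Cons.prems(5) start_in_vertices by simp
    ultimately have "(?x, ?y) = (X - 1, Y + 1)"
      using Cons.prems(1) by (cases s; simp add: clear_def is_center_def; presburger)
    then show ?thesis using start_in_vertices[of ?x ?y w] by simp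
  next
    case False
    then have "(X - 1, Y + 1) \<in> vertices ?x ?y w"
      using Cons.prems by (intro Cons.IH) auto
    then show ?thesis by simp
  qed
qed simp

section \<open>Identification of the kissing circles\<close>

lemma sphere_lattice_point_iff:
  "z \<in> sphere (lattice_point X Y) 2 \<longleftrightarrow>
     (Re z - of_int X)\<^sup>2 + (Im z - sqrt 3 * of_int Y)\<^sup>2 = 4"
proof -
  have "z \<in> sphere (lattice_point X Y) 2 \<longleftrightarrow> cmod (z - lattice_point X Y) = 2"
    by (simp add: dist_norm norm_minus_commute)
  also have "\<dots> \<longleftrightarrow> (cmod (z - lattice_point X Y))\<^sup>2 = 2\<^sup>2"
    by (subst power2_eq_iff_nonneg) auto
  finally show ?thesis by (simp add: cmod_power2)
qed

lemma sphere_lattice_point_bounds: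
  assumes "z \<in> sphere (lattice_point X Y) 2"
  shows "\<bar>Re z - of_int X\<bar> \<le> 2"
    and "Im z \<le> sqrt 3 * of_int Y + sqrt (4 - (Re z - of_int X)\<^sup>2)"
proof -
  have circle: "(Re z - of_int X)\<^sup>2 + (Im z - sqrt 3 * of_int Y)\<^sup>2 = 4"
    using assms by (simp only: sphere_lattice_point_iff)
  then have "(Re z - of_int X)\<^sup>2 \<le> 4"
    using zero_le_power2[of "Im z - sqrt 3 * of_int Y"] by linarith
  then show "\<bar>Re z - of_int X\<bar> \<le> 2" using abs_le_square_iff[of "Re z - of_int X" 2] by simp
  have "Im z - sqrt 3 * of_int Y \<le> sqrt (4 - (Re z - of_int X)\<^sup>2)"
    using circle by (intro real_le_rsqrt) linarith
  then show "Im z \<le> sqrt 3 * of_int Y + sqrt (4 - (Re z - of_int X)\<^sup>2)" by linarith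
qed

definition touched :: "int \<Rightarrow> int \<Rightarrow> step list \<Rightarrow> (int \<times> int) set" where
  "touched x y w = {(X, Y). is_center X Y \<and>
     ((X - 1, Y + 1) \<in> vertices x y w \<or> (X + 1, Y + 1) \<in> vertices x y w)}"

text \<open>A circle below the path has only clear vertices, so contact occurs at a vertex, and
  contact at an end of the diameter entails contact at 120 or 60 degrees. Conversely, a vertex at
  such a point makes every vertex clear, hence the whole trace.\<close>

lemma kissing_circles_arcs_from:
  assumes "accepts (Pole, 0) w"
  shows "kissing_circles (arcs_from 0 0 w) = (\<lambda>(X, Y). lattice_point X Y) ` touched 0 0 w"
proof (intro equalityI subsetI)
  define n where "n = int (word_width w)"
  have ok: "centers_ok 0 0 w" and nonneg: "\<And>u v. (u, v) \<in> vertices 0 0 w \<Longrightarrow> 0 \<le> v"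
    and "total_rise w = 0"
    using assms by (auto simp: accepts_iff[OF located_origin])
  then have last: "endpoint (arcs_from 0 0 w) = lattice_point n 0"
    by (simp add: endpoint_arcs_from n_def)
  have width: "width (arcs_from 0 0 w) = of_int n"
    by (simp add: width_def last)
  {
    fix c assume "c \<in> kissing_circles (arcs_from 0 0 w)"
    then obtain X Y where c: "c = lattice_point X Y" and center: "is_center X Y"
      and below: "below_path c (arcs_from 0 0 w)"
      and touch: "sphere c 2 \<inter> path_trace (arcs_from 0 0 w) \<noteq> {}"
      by (auto simp: kissing_circles_def packing_centers_eq)
    have XY: "0 \<le> Y" "0 \<le> X" "X \<le> n"
      using below by (auto simp: below_path_def c width zero_le_mult_iff)
    have "clear X Y (u, v)" if uv: "(u, v) \<in> vertices 0 0 w" for u v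
    proof (cases "\<bar>u - X\<bar> \<le> 2")
      case True
      define h where "h = sqrt (4 - (of_int u - of_int X)\<^sup>2)"
      have "\<bar>real_of_int u - of_int X\<bar> \<le> 2" using True by linarith
      then have sq: "(real_of_int u - of_int X)\<^sup>2 \<le> 4"
        using abs_le_square_iff[of "real_of_int u - of_int X" 2] by simp
      \<comment> \<open>The point of the upper half of the circle on the vertical line through the
        vertex.\<close>
      define z where "z = Complex (of_int u) (sqrt 3 * of_int Y + h)"
      have "z \<in> sphere c 2"
        unfolding c sphere_lattice_point_iff using sq by (simp add: z_def h_def)
      moreover have "Re (lattice_point u v) = Re z" by (simp add: z_def)
      ultimately have "Im z \<le> Im (lattice_point u v)"
        using below vertex_in_trace[OF uv] unfolding below_path_def by blast
      then have le: "sqrt 3 * of_int Y + h \<le> sqrt 3 * of_int v" by (simp add: z_def)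
      have "0 \<le> h" using sq by (simp add: h_def)
      then have "sqrt 3 * real_of_int Y \<le> sqrt 3 * of_int v" using le by linarith
      then have "Y \<le> v" by simp
      moreover have "Y < v" if "\<bar>u - X\<bar> < 2"
      proof -
        have "\<bar>real_of_int u - of_int X\<bar> \<le> 1" using that by linarith
        then have "(real_of_int u - of_int X)\<^sup>2 \<le> 1" by (simp add: abs_square_le_1)
        then have "0 < h" by (simp add: h_def)
        then have "sqrt 3 * real_of_int Y < sqrt 3 * of_int v" using le by linarith
        then show ?thesis by simp
      qed
      ultimately show ?thesis by (simp add: clear_def)
    qed (simp add: clear_def)
    then have clear: "\<forall>p\<in>vertices 0 0 w. clear X Y p" by auto
    obtain z where sphere: "z \<in> sphere (lattice_point X Y) 2"
      and z: "z \<in> path_trace (arcs_from 0 0 w)"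
      using touch c by auto
    note range = sphere_lattice_point_bounds(1)[OF sphere]
    have "Im z = sqrt 3 * of_int Y + sqrt (4 - (Re z - of_int X)\<^sup>2)"
      using trace_clear(1)[OF center ok XY(1) clear z range]
        sphere_lattice_point_bounds(2)[OF sphere] by linarith
    then have "vertices 0 0 w \<inter> contacts X Y \<noteq> {}"
      by (rule trace_clear(2)[OF center ok XY(1) clear z range])
    moreover have "(X + 1, Y + 1) \<in> vertices 0 0 w" if "(X + 2, Y) \<in> vertices 0 0 w"
      using contact_on_right[OF center ok that _ clear] XY by simp
    moreover have "(X - 1, Y + 1) \<in> vertices 0 0 w" if "(X - 2, Y) \<in> vertices 0 0 w"
      using contact_on_left[OF center ok that _ clear] XY by (simp add: n_def)
    ultimately have "(X, Y) \<in> touched 0 0 w"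
      using center by (auto simp: touched_def contacts_def)
    then show "c \<in> (\<lambda>(X, Y). lattice_point X Y) ` touched 0 0 w"
      using c by force
  next
    fix c assume "c \<in> (\<lambda>(X, Y). lattice_point X Y) ` touched 0 0 w"
    then obtain X Y u where c: "c = lattice_point X Y" and center: "is_center X Y"
      and uv: "(u, Y + 1) \<in> vertices 0 0 w" and u: "u = X - 1 \<or> u = X + 1"
      by (auto simp: touched_def)
    have "even Y" using center by (simp add: is_center_def)
    then have "0 \<le> Y" using nonneg[OF uv] by presburger
    \<comment> \<open>The vertex has positive ordinate, so it is neither end of the path and
      \<open>0 < u < n\<close>; moreover \<open>u\<close> and \<open>X\<close> differ by 1.\<close>
    have X: "0 \<le> X" "X \<le> n"
      using vertices_from_start[OF uv] vertices_to_end[OF uv] u \<open>0 \<le> Y\<close> \<open>total_rise w = 0\<close>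
      by (auto simp: n_def)
    have "clear X Y (u', v')" if "(u', v') \<in> vertices 0 0 w" for u' v'
      by (rule all_clear[OF center ok uv _ _ that]) (use u in auto)
    then have clear: "\<forall>p\<in>vertices 0 0 w. clear X Y p" by auto
    have "Im z \<le> Im w'" if z: "z \<in> sphere c 2" and w': "w' \<in> path_trace (arcs_from 0 0 w)"
      and Re: "Re w' = Re z" for z w'
    proof -
      note bounds = sphere_lattice_point_bounds[OF z[unfolded c]]
      then have "\<bar>Re w' - of_int X\<bar> \<le> 2" using Re by simp
      then show ?thesis
        using trace_clear(1)[OF center ok \<open>0 \<le> Y\<close> clear w'] bounds(2) unfolding Re by linarith
    qed
    moreover have "0 \<le> Im c" "0 \<le> Re c" "Re c \<le> width (arcs_from 0 0 w)"
      using X \<open>0 \<le> Y\<close> by (simp_all add: c width)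
    ultimately have "below_path c (arcs_from 0 0 w)"
      unfolding below_path_def by blast
    moreover have "lattice_point u (Y + 1) \<in> sphere c 2"
      unfolding c sphere_lattice_point_iff using u by (auto simp: algebra_simps)
    moreover have "lattice_point u (Y + 1) \<in> path_trace (arcs_from 0 0 w)"
      by (rule vertex_in_trace[OF uv])
    ultimately show "c \<in> kissing_circles (arcs_from 0 0 w)"
      using c center by (auto simp: kissing_circles_def packing_centers_eq)
  }
qed

text \<open>The circle already counted on arrival at a state, and a lower bound for the abscissas of the
  centres of the circles that are counted later.\<close>

fun old_circle :: "kind \<Rightarrow> int \<Rightarrow> int \<Rightarrow> (int \<times> int) set" where
  "old_circle Pole x y = {}"
| "old_circle Summit x y = {(x, y - 2)}"
| "old_circle Lft x y = {(x + 1, y - 1)}"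
| "old_circle Rgt x y = {(x - 1, y - 1)}"

fun leftmost_new :: "kind \<Rightarrow> int \<Rightarrow> int" where
  "leftmost_new Pole x = x"
| "leftmost_new Summit x = x + 2"
| "leftmost_new Lft x = x + 3"
| "leftmost_new Rgt x = x + 1"

lemma touched_Nil:
  "located (k, m) x y \<Longrightarrow> touched x y [] \<subseteq> old_circle k x y"
  by (cases k; auto simp: touched_def is_center_def; presburger)

lemma old_circle_touched:
  assumes "located (k, m) x y" "k = Lft \<or> k = Rgt"
  shows "old_circle k x y \<subseteq> touched x y w"
proof -
  have start: "(x, y) \<in> vertices x y w" by (rule start_in_vertices)
  from assms(2) show ?thesis
  proof
    assume k: "k = Lft"
    then have "is_center (x + 1) (y - 1)"
      using assms(1) by (simp add: is_center_def; presburger)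
    then show ?thesis using start k by (simp add: touched_def)
  next
    assume k: "k = Rgt"
    then have "is_center (x - 1) (y - 1)"
      using assms(1) by (simp add: is_center_def; presburger)
    then show ?thesis using start k by (simp add: touched_def)
  qed
qed

lemma touched_Cons:
  "touched x y (s # w) = touched x y [] \<union> touched (x + run s) (y + rise s) w"
  by (auto simp: touched_def)

text \<open>\<open>Up_bar\<close> hands the old circle on to \<open>Summit\<close>, which is why a
  subsequent \<open>Down_bar\<close> adds nothing. The bounds on abscissas separate a circle met now
  from all those met later.\<close>

lemma old_circle_step:
  assumes "located (k, m) x y" "next_state (k, m) s = Some (k', m')"
  defines "x' \<equiv> x + run s" and "y' \<equiv> y + rise s"
  shows "old_circle k' x' y' \<subseteq> touched x' y' w \<union> old_circle k x y"
    and "card (old_circle k' x' y' - old_circle k x y) = new_circles k s"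
    and "(X, Y) \<in> old_circle k' x' y' - old_circle k x y \<Longrightarrow>
      leftmost_new k x \<le> X \<and> X < leftmost_new k' x'"
    and "leftmost_new k x \<le> leftmost_new k' x'"
proof -
  show "old_circle k' x' y' \<subseteq> touched x' y' w \<union> old_circle k x y"
  proof (cases "k' = Lft \<or> k' = Rgt")
    case True
    have "located (k', m') x' y'"
      using next_state_located[OF assms(1), of s] assms(2) by (simp add: x'_def y'_def)
    then show ?thesis using old_circle_touched True by blast
  next
    case False
    then show ?thesis
      using assms(2) unfolding x'_def y'_def by (cases k; cases m; cases s) auto
  qed
  show "card (old_circle k' x' y' - old_circle k x y) = new_circles k s"
    using assms by (cases k; cases m; cases s) auto
  show "(X, Y) \<in> old_circle k' x' y' - old_circle k x y \<Longrightarrow>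
      leftmost_new k x \<le> X \<and> X < leftmost_new k' x'"
    using assms by (cases k; cases m; cases s) auto
  show "leftmost_new k x \<le> leftmost_new k' x'"
    using assms by (cases k; cases m; cases s) auto
qed

text \<open>Whether the rest of the path touches the old circle again depends on the state and, at
  \<open>Summit\<close>, on the word. Adding it on both sides makes the claim uniform, and
  \<open>N\<close> collects the circles still to be counted.\<close>

lemma touched_count:
  "located (k, m) x y \<Longrightarrow> accepts (k, m) w \<Longrightarrow>
     \<exists>N. touched x y w \<union> old_circle k x y = N \<union> old_circle k x y \<and> finite N \<and>
       card N = circle_count (k, m) w \<and> (\<forall>(X, Y)\<in>N. leftmost_new k x \<le> X)"
proof (induction w arbitrary: k m x y)
  case Nil
  then show ?case using touched_Nil[OF Nil(1)] by (intro exI[of _ "{}"]) auto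
next
  case (Cons s w)
  let ?x = "x + run s" and ?y = "y + rise s"
  obtain k' m' where step: "next_state (k, m) s = Some (k', m')" and acc: "accepts (k', m') w"
    using Cons.prems(2) by (auto split: option.splits)
  have loc: "located (k', m') ?x ?y"
    using next_state_located[OF Cons.prems(1), of s] step by simp
  obtain N where N: "touched ?x ?y w \<union> old_circle k' ?x ?y = N \<union> old_circle k' ?x ?y"
    "finite N" "card N = circle_count (k', m') w" "\<forall>(X, Y)\<in>N. leftmost_new k' ?x \<le> X"
    using Cons.IH[OF loc acc] by (elim exE conjE) (rule that)
  note old = old_circle_step[OF Cons.prems(1) step]
  define M where "M = old_circle k' ?x ?y - old_circle k x y"
  have "finite M" by (cases k') (auto simp: M_def)
  have "touched x y (s # w) \<union> old_circle k x y = (M \<union> N) \<union> old_circle k x y"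
    using touched_Nil[OF Cons.prems(1)] touched_Cons[of x y s w] old(1)[of w] N(1)
    unfolding M_def by blast
  moreover have new: "leftmost_new k x \<le> X \<and> X < leftmost_new k' ?x" if "(X, Y) \<in> M" for X Y
    using old(3) that unfolding M_def by blast
  \<comment> \<open>The bound \<open>leftmost_new k' ?x\<close> lies to the right of
    \<open>M\<close> and weakly to the left of \<open>N\<close>, so no circle is counted
    twice.\<close>
  have "(X, Y) \<notin> N" if "(X, Y) \<in> M" for X Y
    using new[OF that] N(4) by auto
  then have "M \<inter> N = {}" by auto
  then have "card (M \<union> N) = circle_count (k, m) (s # w)"
    using old(2) N(2,3) \<open>finite M\<close> step by (simp add: card_Un_disjoint M_def)
  moreover have "\<forall>(X, Y)\<in>M \<union> N. leftmost_new k x \<le> X"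
    using new old(4) N(4) by fastforce
  ultimately show ?case using \<open>finite M\<close> N(2) by (intro exI[of _ "M \<union> N"]) auto
qed

lemma kiss_arcs_from:
  assumes "accepts (Pole, 0) w"
  shows "kiss (arcs_from 0 0 w) = circle_count (Pole, 0) w"
proof -
  have "inj_on (\<lambda>(X, Y). lattice_point X Y) (touched 0 0 w)"
    by (auto intro!: inj_onI)
  then have "kiss (arcs_from 0 0 w) = card (touched 0 0 w)"
    by (simp add: kiss_def kissing_circles_arcs_from[OF assms] card_image)
  \<comment> \<open>At \<open>Pole\<close> there is no old circle, so the set \<open>N\<close> is
    the touched set itself.\<close>
  also have "\<dots> = circle_count (Pole, 0) w"
    using touched_count[OF located_origin assms] by auto
  finally show ?thesis .
qed

section \<open>Transfer to packing paths and conclusion\<close>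

lemma packing_gf_eq: "packing_gf = state_gf (Pole, 0)"
proof -
  \<comment> \<open>Reading off the types of the arcs inverts \<open>arcs_from\<close>, and both
    statistics are preserved.\<close>
  have "bij_betw (arcs_from 0 0) (words (Pole, 0) n k)
      {P. packing_path P \<and> width P = of_nat n \<and> kiss P = k}" for n k
  proof (rule bij_betw_imageI)
    show "inj_on (arcs_from 0 0) (words (Pole, 0) n k)"
      by (rule inj_on_inverseI[of _ "map snd"]) simp
    have "width (arcs_from 0 0 w) = of_nat (word_width w)" for w
      by (simp add: width_def endpoint_arcs_from)
    then show "arcs_from 0 0 ` words (Pole, 0) n k =
        {P. packing_path P \<and> width P = of_nat n \<and> kiss P = k}"
      by (auto simp: words_def packing_path_iff kiss_arcs_from)
  qed
  then have "card {P. packing_path P \<and> width P = of_nat n \<and> kiss P = k} = card (words (Pole, 0) n k)"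
    for n k by (rule bij_betw_same_card[symmetric])
  then show ?thesis by (simp add: packing_gf_def state_gf_def)
qed

theorem theorem8:
  fixes x y :: "real fps fps"
  defines "x \<equiv> fps_X" and "y \<equiv> fps_const fps_X"
  shows "to_fract packing_gf =
    to_fract (1 - 4 * x^4 * y + 3 * x^4 * y^2
      - fps2_sqrt (1 - 8 * x^4 * y - 2 * x^4 * y^2 + 16 * x^8 * y^2 - 8 * x^8 * y^3 + x^8 * y^4))
    / to_fract (4 * x^4 * y^2)"
proof (rule to_fract_eq_divide)
  show "4 * x^4 * y^2 \<noteq> 0" by (simp add: x_def y_def)
  obtain A where A: "A = 1 + x ^ 4 * y * (2 - y + y * A) * (2 * A - 1)"
    unfolding x_def by (rule packing_equation_solution)
  show "4 * x^4 * y^2 * packing_gf = 1 - 4 * x^4 * y + 3 * x^4 * y^2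
      - fps2_sqrt (1 - 8 * x^4 * y - 2 * x^4 * y^2 + 16 * x^8 * y^2 - 8 * x^8 * y^3 + x^8 * y^4)"
    unfolding packing_gf_eq
    using packing_equation_state_gf[OF A[unfolded x_def y_def]]
      packing_equation_closed_form[OF A[unfolded x_def y_def]] by (simp add: x_def y_def)
qed

end
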